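(* Let $k$ be an algebraically closed subfield of $\mathbb{C}$, let $L=p_0\partial_x^n+\cdots+p_{n-1}\partial_x+p_n$ with $p_i\in k[x]$, $p_0\neq 0$, $n\ge 1$, be a Fuchsian differential operator with set of singularities $S=\{t_1,\dots,t_r,\infty\}$ ($t_1,\dots,t_r\in k$ pairwise distinct), and let $f$ be a solution of $L$, i.e. $Lf=0$. If $L$ has no integer exponent $\geq n$ at any finite point and no positive integer exponent at $\infty$, then the $k$-vector space $H^1_{\mathrm{dR}}(\mathbb{P}^1-S,L)$ is generated by the classes of $$(x-t_j)^{-1}f^{(i)}\,dx,\qquad j=1,2,\dots,r,\quad i=0,1,\dots,n-1,$$ and so it is of dimension at most $n\cdot r$.
   Context: Here $\partial_x=d/dx$ and $f^{(i)}=\partial_x^i f$. The finite singularities $t_1,\dots,t_r$ of $L$ are the poles of the rational functions $p_i/p_0$, $i=1,\dots,n$; the point $\infty$ is always included in $S$. $L$ is Fuchsian, i.e. it has only regular singularities on $\mathbb{P}^1$: $p_i/p_0$ has a pole of order at most $i$ at every finite point and vanishes to order at least $i$ at $\infty$. A solution $f$ is a (multivalued) holomorphic function on $\mathbb{C}\setminus\{t_1,\dots,t_r\}$ with $Lf=0$; one may fix a branch on a nonempty simply connected open set, and all differential forms below are regarded as holomorphic 1-forms there. Cohomology group (it depends on $f$, which is suppressed in the notation): $$H^1_{\mathrm{dR}}(\mathbb{P}^1-S,L):=\frac{\langle p f^{(i)}dx \mid p\in k(x),\ \mathrm{pol}(p)\subset S,\ i=0,1,\dots,n-1\rangle_k}{\langle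 d(pf^{(i)})\mid p\in k(x),\ \mathrm{pol}(p)\subset S,\ i=0,1,\dots,n-1\rangle_k},$$ where $\mathrm{pol}(p)$ is the set of poles of $p$ on $\mathbb{P}^1$ and $\langle\cdot\rangle_k$ denotes $k$-linear span. Exponents: for a finite point $t$ put $a_{i,t}:=\lim_{x\to t}(x-t)^i\frac{p_i}{p_0}$, and put $a_{i,\infty}:=\lim_{x\to\infty}(-x)^i\frac{p_i}{p_0}$. The indicial polynomials are $$I_t(X)=X(X-1)\cdots(X-n+1)+a_{1,t}X(X-1)\cdots(X-n+2)+\cdots+a_{n,t},$$ $$I_\infty(X)=X(X+1)\cdots(X+n-1)+a_{1,\infty}X(X+1)\cdots(X+n-2)+\cdots+a_{n,\infty}.$$ The exponents of $L$ at $t$ (the Riemann scheme of $L$ at $t$) are the roots of $I_t$, for $t$ finite or $t=\infty$. *)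

theory Defs
  imports "HOL-Complex_Analysis.Complex_Analysis" "HOL-Algebra.Module" "HOL-Algebra.AbelCoset"
begin

section \<open>Spans, bases and quotients of modules given by a carrier set\<close>

text \<open>As in the library, the record type of modules extends that of rings; the ring
  multiplication and unit of a module are never used here and are left undefined.\<close>

definition lin_span :: "('a, 'r) ring_scheme \<Rightarrow> ('a, 'b, 'm) module_scheme \<Rightarrow> 'b set \<Rightarrow> 'b set" where
  "lin_span R M X = \<Inter>{N. submodule N R M \<and> X \<subseteq> N}"

definition lin_indep :: "('a, 'r) ring_scheme \<Rightarrow> ('a, 'b, 'm) module_scheme \<Rightarrow> 'b set \<Rightarrow> bool" where
  "lin_indep R M B \<longleftrightarrow>
     (\<forall>A c. finite A \<and> A \<subseteq> B \<and> c \<in> A \<rightarrow> carrier R \<and>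
        finsum M (\<lambda>v. c v \<odot>\<^bsub>M\<^esub> v) A = \<zero>\<^bsub>M\<^esub> \<longrightarrow> (\<forall>v\<in>A. c v = \<zero>\<^bsub>R\<^esub>))"

definition has_dimension :: "('a, 'r) ring_scheme \<Rightarrow> ('a, 'b, 'm) module_scheme \<Rightarrow> nat \<Rightarrow> bool" where
  "has_dimension R M d \<longleftrightarrow>
     (\<exists>B \<subseteq> carrier M. finite B \<and> card B = d \<and> lin_indep R M B \<and> lin_span R M B = carrier M)"

definition quot_module :: "('a, 'b, 'm) module_scheme \<Rightarrow> 'b set \<Rightarrow> ('a, 'b set) module" where
  "quot_module M W =
     \<lparr>carrier = a_rcosets\<^bsub>M\<^esub> W, mult = undefined, one = undefined,
      zero = W, add = set_add M,
      smult = (\<lambda>c X. \<Union>x\<in>X. W +>\<^bsub>M\<^esub> (c \<odot>\<^bsub>M\<^esub> x))\<rparr>"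


section \<open>Algebraically closed subfields of the complex numbers\<close>

definition complex_subring :: "complex set \<Rightarrow> complex ring" where
  "complex_subring k = \<lparr>carrier = k, mult = (*), one = 1, zero = 0, add = (+)\<rparr>"

definition poly_over :: "complex set \<Rightarrow> complex poly set" where
  "poly_over k = {q. \<forall>j. coeff q j \<in> k}"

definition alg_closed_subfield :: "complex set \<Rightarrow> bool" where
  "alg_closed_subfield k \<longleftrightarrow>
     field (complex_subring k) \<and> (\<forall>q\<in>poly_over k. degree q > 0 \<longrightarrow> (\<exists>z\<in>k. poly q z = 0))"

text \<open>Elements of \<open>k(x)\<close> as functions. The fraction is required to be reduced: otherwise
  division by zero would give the function wrong values at removable singularities.\<close>

definition rational_functions :: "complex set \<Rightarrow> (complex \<Rightarrow> complex) set" where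
  "rational_functions k =
     {\<lambda>x. poly a x / poly b x | a b. a \<in> poly_over k \<and> b \<in> poly_over k \<and> b \<noteq> 0 \<and> coprime a b}"

text \<open>Here \<open>T\<close> is the finite part of a set \<open>S = T \<union> {\<infinity>}\<close>; since \<open>\<infinity>\<close> always belongs to \<open>S\<close>,
  the condition that all poles on the projective line lie in \<open>S\<close> only concerns finite poles.\<close>

definition rational_functions_poles :: "complex set \<Rightarrow> complex set \<Rightarrow> (complex \<Rightarrow> complex) set" where
  "rational_functions_poles k T = {q \<in> rational_functions k. {z. is_pole q z} \<subseteq> T}"


section \<open>Linear differential operators\<close>

text \<open>The operator \<open>p\<^sub>0 \<partial>\<^sup>n + p\<^sub>1 \<partial>\<^sup>n\<^sup>-\<^sup>1 + \<cdots> + p\<^sub>n\<close> is encoded by its order \<open>n\<close> and the family \<open>p\<close>.\<close>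

definition normalized_coeff :: "(nat \<Rightarrow> complex poly) \<Rightarrow> nat \<Rightarrow> complex \<Rightarrow> complex" where
  "normalized_coeff p i x = poly (p i) x / poly (p 0) x"

definition finite_singularities :: "nat \<Rightarrow> (nat \<Rightarrow> complex poly) \<Rightarrow> complex set" where
  "finite_singularities n p = {z. \<exists>i\<in>{1..n}. is_pole (normalized_coeff p i) z}"

text \<open>The guard \<open>p i \<noteq> 0\<close> is there because the library's \<open>zorder\<close> is unspecified for functions
  vanishing near the point, whereas the zero function satisfies every bound on the order.\<close>

definition fuchsian :: "nat \<Rightarrow> (nat \<Rightarrow> complex poly) \<Rightarrow> bool" where
  "fuchsian n p \<longleftrightarrow>
     (\<forall>i\<in>{1..n}. p i \<noteq> 0 \<longrightarrow>
        (\<forall>z. zorder (normalized_coeff p i) z \<ge> - int i) \<and>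
        zorder (\<lambda>w. normalized_coeff p i (inverse w)) 0 \<ge> int i)"

definition is_solution ::
    "nat \<Rightarrow> (nat \<Rightarrow> complex poly) \<Rightarrow> complex set \<Rightarrow> (complex \<Rightarrow> complex) \<Rightarrow> bool" where
  "is_solution n p U f \<longleftrightarrow>
     f holomorphic_on U \<and> (\<forall>x\<in>U. (\<Sum>i\<le>n. poly (p i) x * (deriv ^^ (n - i)) f x) = 0)"

definition indicial_coeff :: "(nat \<Rightarrow> complex poly) \<Rightarrow> complex \<Rightarrow> nat \<Rightarrow> complex" where
  "indicial_coeff p t i = Lim (at t) (\<lambda>x. (x - t) ^ i * normalized_coeff p i x)"

definition indicial_coeff_infinity :: "(nat \<Rightarrow> complex poly) \<Rightarrow> nat \<Rightarrow> complex" where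
  "indicial_coeff_infinity p i = Lim at_infinity (\<lambda>x. (- x) ^ i * normalized_coeff p i x)"

definition falling_poly :: "nat \<Rightarrow> complex poly" where
  "falling_poly m = (\<Prod>j<m. [:- of_nat j, 1:])"

definition rising_poly :: "nat \<Rightarrow> complex poly" where
  "rising_poly m = (\<Prod>j<m. [:of_nat j, 1:])"

definition indicial_poly :: "nat \<Rightarrow> (nat \<Rightarrow> complex poly) \<Rightarrow> complex \<Rightarrow> complex poly" where
  "indicial_poly n p t =
     falling_poly n + (\<Sum>i=1..n. Polynomial.smult (indicial_coeff p t i) (falling_poly (n - i)))"

definition indicial_poly_infinity :: "nat \<Rightarrow> (nat \<Rightarrow> complex poly) \<Rightarrow> complex poly" where
  "indicial_poly_infinity n p =
     rising_poly n + (\<Sum>i=1..n. Polynomial.smult (indicial_coeff_infinity p i) (rising_poly (n - i)))"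

definition exponents :: "nat \<Rightarrow> (nat \<Rightarrow> complex poly) \<Rightarrow> complex \<Rightarrow> complex set" where
  "exponents n p t = {\<rho>. poly (indicial_poly n p t) \<rho> = 0}"

definition exponents_infinity :: "nat \<Rightarrow> (nat \<Rightarrow> complex poly) \<Rightarrow> complex set" where
  "exponents_infinity n p = {\<rho>. poly (indicial_poly_infinity n p) \<rho> = 0}"


section \<open>The de Rham cohomology group\<close>

text \<open>A holomorphic 1-form \<open>g dx\<close> on \<open>U\<close> is represented by its coefficient \<open>g\<close>, extended by \<open>0\<close>
  outside \<open>U\<close> so that equality of forms is equality of functions. The exact form \<open>dh\<close> is
  \<open>one_form U (deriv h)\<close>.\<close>

definition one_form :: "complex set \<Rightarrow> (complex \<Rightarrow> complex) \<Rightarrow> complex \<Rightarrow> complex" where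
  "one_form U g = (\<lambda>x. if x \<in> U then g x else 0)"

definition holomorphic_forms :: "complex set \<Rightarrow> (complex, complex \<Rightarrow> complex) module" where
  "holomorphic_forms U =
     \<lparr>carrier = {g. g holomorphic_on U \<and> (\<forall>x. x \<notin> U \<longrightarrow> g x = 0)},
      mult = undefined, one = undefined,
      zero = (\<lambda>_. 0), add = (\<lambda>g h x. g x + h x), smult = (\<lambda>c g x. c * g x)\<rparr>"

definition dR_forms ::
    "complex set \<Rightarrow> complex set \<Rightarrow> complex set \<Rightarrow> nat \<Rightarrow> (complex \<Rightarrow> complex) \<Rightarrow> (complex \<Rightarrow> complex) set"
  where
  "dR_forms k T U n f = lin_span (complex_subring k) (holomorphic_forms U)
     {one_form U (\<lambda>x. q x * (deriv ^^ i) f x) | q i. q \<in> rational_functions_poles k T \<and> i < n}"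

definition dR_exact ::
    "complex set \<Rightarrow> complex set \<Rightarrow> complex set \<Rightarrow> nat \<Rightarrow> (complex \<Rightarrow> complex) \<Rightarrow> (complex \<Rightarrow> complex) set"
  where
  "dR_exact k T U n f = lin_span (complex_subring k) (holomorphic_forms U)
     {one_form U (deriv (\<lambda>x. q x * (deriv ^^ i) f x)) | q i. q \<in> rational_functions_poles k T \<and> i < n}"

definition H1_dR ::
    "complex set \<Rightarrow> complex set \<Rightarrow> complex set \<Rightarrow> nat \<Rightarrow> (complex \<Rightarrow> complex)
       \<Rightarrow> (complex, (complex \<Rightarrow> complex) set) module" where
  "H1_dR k T U n f =
     quot_module ((holomorphic_forms U)\<lparr>carrier := dR_forms k T U n f\<rparr>) (dR_exact k T U n f)"

definition dR_class ::
    "complex set \<Rightarrow> complex set \<Rightarrow> complex set \<Rightarrow> nat \<Rightarrow> (complex \<Rightarrow> complex) \<Rightarrow> (complex \<Rightarrow> complex)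
       \<Rightarrow> (complex \<Rightarrow> complex) set" where
  "dR_class k T U n f g = dR_exact k T U n f +>\<^bsub>holomorphic_forms U\<^esub> one_form U g"

end

theory Submission
  imports Defs "HOL-Computational_Algebra.Fundamental_Theorem_Algebra"
begin

text \<open>Write \<open>R\<close> for the product of the \<open>x - t\<close> over the finite singularities \<open>t\<close>, and \<open>\<equiv>\<close> for equality
  modulo exact forms. By the Fuchs conditions \<open>p i / p 0 = A i / R ^ i\<close> with polynomials \<open>A i\<close> over
  \<open>k\<close> whose degree is at most \<open>i * deg R - i\<close> (lemma \<open>fuchsian_coefficient\<close>). The regularity of the
  singular points enters only through this normal form.

  Integration by parts gives \<open>q f\<^sup>(\<^sup>i\<^sup>) dx \<equiv> (-1)\<^sup>i q\<^sup>(\<^sup>i\<^sup>) f dx\<close>, so every class is represented by some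
  \<open>q f dx\<close> with \<open>q = P / R ^ N\<close>. Multiplying the equation by \<open>q\<close> and integrating by parts shows that
  \<open>L\<^sup>*(q) f dx\<close> is exact, where \<open>L\<^sup>*\<close> is the adjoint of the monic operator \<open>L / p 0\<close>. The operator
  \<open>L\<^sup>*\<close> acts on leading terms by the indicial polynomials: it sends \<open>(x - t)\<^sup>-\<^sup>m\<close> to
  \<open>I\<^sub>t(n - 1 + m) (x - t)\<^sup>-\<^sup>m\<^sup>-\<^sup>n\<close> up to a smaller pole at \<open>t\<close>, and \<open>x\<^sup>m\<close> to
  \<open>(-1)\<^sup>n I\<^sub>\<infinity>(m - n + 1) x\<^sup>m\<^sup>-\<^sup>n\<close> up to terms of lower degree (lemmas \<open>adjoint_numerator_at_root\<close> and
  \<open>adjoint_numerator_leading\<close>). The hypotheses on the exponents say exactly that these factors are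
  nonzero for \<open>m \<ge> 1\<close> and for \<open>m \<ge> n\<close> respectively. Hence modulo exact forms the
  polynomial part of \<open>q\<close> can be removed degree by degree, and then its poles of order greater than
  \<open>n\<close> can be lowered one order at a time (lemmas \<open>fraction_in_S\<close>, \<open>pole_killer\<close> and
  \<open>proper_fraction_in_S\<close>).

  What remains is a combination of the forms \<open>(x - t)\<^sup>-\<^sup>e f dx\<close> with \<open>1 \<le> e \<le> n\<close>, and these are
  multiples of \<open>(x - t)\<^sup>-\<^sup>1 f\<^sup>(\<^sup>e\<^sup>-\<^sup>1\<^sup>) dx\<close> modulo exact forms, again by integration by parts (lemma
  \<open>simple_pole_power_in_S\<close>). This is the asserted system of \<open>n * r\<close> generators, and a generating set
  of minimal size contained in it is a basis.\<close>

section \<open>Generators, dimension and quotients of modules\<close>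

lemma (in Module.module) submoduleI_smult:
  assumes "H \<subseteq> carrier M" "\<zero>\<^bsub>M\<^esub> \<in> H"
    and "\<And>a b. a \<in> H \<Longrightarrow> b \<in> H \<Longrightarrow> a \<oplus>\<^bsub>M\<^esub> b \<in> H"
    and smult: "\<And>a x. a \<in> carrier R \<Longrightarrow> x \<in> H \<Longrightarrow> a \<odot>\<^bsub>M\<^esub> x \<in> H"
  shows "submodule H R M"
proof (rule submoduleI)
  fix a assume "a \<in> H"
  moreover from this have "\<ominus>\<^bsub>M\<^esub> a = (\<ominus>\<^bsub>R\<^esub> \<one>\<^bsub>R\<^esub>) \<odot>\<^bsub>M\<^esub> a" using assms(1) by (simp add: smult_l_minus subset_iff)
  ultimately show "\<ominus>\<^bsub>M\<^esub> a \<in> H" using smult by simp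
qed (use assms in auto)

lemma (in Module.module) lin_span_submodule:
  assumes "X \<subseteq> carrier M"
  shows "submodule (lin_span R M X) R M"
proof (rule submoduleI)
  show "lin_span R M X \<subseteq> carrier M"
    using carrier_is_submodule assms unfolding lin_span_def by blast
next
  show "\<zero>\<^bsub>M\<^esub> \<in> lin_span R M X"
    unfolding lin_span_def using subgroup.one_closed[OF submodule.axioms(1)] by fastforce
qed (use submoduleE in \<open>auto simp: lin_span_def\<close>)

lemma lin_span_superset: "X \<subseteq> lin_span R M X"
  unfolding lin_span_def by blast

lemma lin_span_minimal: "submodule N R M \<Longrightarrow> X \<subseteq> N \<Longrightarrow> lin_span R M X \<subseteq> N"
  unfolding lin_span_def by blast

lemma (in Module.module) submodule_finsum_closed:
  assumes N: "submodule N R M" and "finite A" "g ` A \<subseteq> N"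
  shows "finsum M g A \<in> N"
  using assms(2,3)
proof (induction A)
  case empty
  show ?case using subgroup.one_closed[OF submodule.axioms(1)[OF N]] by simp
next
  case (insert x F)
  have "g \<in> F \<rightarrow> carrier M" "g x \<in> carrier M"
    using insert.prems submoduleE(1)[OF N] by auto
  then show ?case
    using insert submoduleE(5)[OF N] by simp
qed

text \<open>A generating subset of minimal size is independent: from a nontrivial relation some vector of it
  could be expressed by the others and discarded.\<close>
lemma (in Module.module) has_dimension_of_finite_generators:
  assumes R: "field R" and X: "finite X" "X \<subseteq> carrier M" and span: "lin_span R M X = carrier M"
  shows "\<exists>d\<le>card X. has_dimension R M d"
proof -
  define P where "P B \<longleftrightarrow> B \<subseteq> X \<and> lin_span R M B = carrier M" for B
  have "P X" using span by (simp add: P_def)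
  then obtain B where B: "P B" and Bmin: "\<And>C. P C \<Longrightarrow> card B \<le> card C"
    using ex_has_least_nat[of P X card] by blast
  have BX: "B \<subseteq> X" and Bspan: "lin_span R M B = carrier M" using B by (auto simp: P_def)
  have finB: "finite B" using BX X(1) finite_subset by blast
  have "lin_indep R M B"
    unfolding lin_indep_def
  proof (intro allI impI ballI, elim conjE, rule ccontr)
    fix A c v
    assume A: "finite A" "A \<subseteq> B" and c: "c \<in> A \<rightarrow> carrier R"
      and dep: "finsum M (\<lambda>v. c v \<odot>\<^bsub>M\<^esub> v) A = \<zero>\<^bsub>M\<^esub>"
      and v: "v \<in> A" and nz: "c v \<noteq> \<zero>\<^bsub>R\<^esub>"
    let ?N = "lin_span R M (B - {v})"
    have N: "submodule ?N R M"
      using BX X(2) by (intro lin_span_submodule) auto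
    have vM: "v \<in> carrier M" using v A BX X by auto
    have unit: "c v \<in> Units R" using field.field_Units[OF R] c v nz by auto
    let ?s = "finsum M (\<lambda>v. c v \<odot>\<^bsub>M\<^esub> v) (A - {v})"
    have s: "?s \<in> ?N"
    proof (rule submodule_finsum_closed[OF N])
      show "(\<lambda>v. c v \<odot>\<^bsub>M\<^esub> v) ` (A - {v}) \<subseteq> ?N"
        using submoduleE(4)[OF N] c A lin_span_superset[of "B - {v}" R M] by blast
    qed (use A in auto)
    have "finsum M (\<lambda>v. c v \<odot>\<^bsub>M\<^esub> v) (insert v (A - {v})) = c v \<odot>\<^bsub>M\<^esub> v \<oplus>\<^bsub>M\<^esub> ?s"
    proof (rule finsum_insert)
      show "(\<lambda>v. c v \<odot>\<^bsub>M\<^esub> v) \<in> A - {v} \<rightarrow> carrier M"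
        using c A BX X by (intro funcsetI smult_closed) auto
    qed (use A c v vM in auto)
    then have sum0: "c v \<odot>\<^bsub>M\<^esub> v \<oplus>\<^bsub>M\<^esub> ?s = \<zero>\<^bsub>M\<^esub>"
      using dep v by (simp add: insert_absorb)
    have sM: "?s \<in> carrier M" using s submoduleE(1)[OF N] by blast
    have cvM: "c v \<odot>\<^bsub>M\<^esub> v \<in> carrier M" using c v vM by auto
    have "c v \<odot>\<^bsub>M\<^esub> v = \<ominus>\<^bsub>M\<^esub> ?s"
      using M.minus_equality[OF sum0 sM cvM] by simp
    then have "c v \<odot>\<^bsub>M\<^esub> v \<in> ?N" using submoduleE(3)[OF N s] by simp
    then have "inv\<^bsub>R\<^esub> (c v) \<odot>\<^bsub>M\<^esub> (c v \<odot>\<^bsub>M\<^esub> v) \<in> ?N"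
      using submoduleE(4)[OF N] unit by simp
    also have "inv\<^bsub>R\<^esub> (c v) \<odot>\<^bsub>M\<^esub> (c v \<odot>\<^bsub>M\<^esub> v) = v"
      using smult_assoc1[of "inv\<^bsub>R\<^esub> (c v)" "c v" v] unit vM c v by auto
    finally have "v \<in> ?N" .
    then have "B \<subseteq> ?N" using lin_span_superset[of "B - {v}" R M] by blast
    then have "lin_span R M B \<subseteq> ?N" by (rule lin_span_minimal[OF N])
    then have "P (B - {v})"
      using Bspan submoduleE(1)[OF N] BX unfolding P_def by blast
    moreover have "card (B - {v}) < card B" using v A finB by (intro psubset_card_mono) auto
    ultimately show False using Bmin by fastforce
  qed
  then have "has_dimension R M (card B)"
    unfolding has_dimension_def using BX X finB Bspan by (intro exI[of _ B]) auto
  then show ?thesis using BX X card_mono by blast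
qed

lemma (in Module.module) submodule_abelian_subgroup:
  "submodule W R M \<Longrightarrow> abelian_subgroup W M"
  by (rule abelian_subgroupI3[OF additive_subgroup.intro])
     (auto intro: submodule.axioms M.abelian_group_axioms)

lemma (in Module.module) quot_module_smult:
  assumes W: "submodule W R M" and c: "c \<in> carrier R" and g: "g \<in> carrier M"
  shows "c \<odot>\<^bsub>quot_module M W\<^esub> (W +>\<^bsub>M\<^esub> g) = W +>\<^bsub>M\<^esub> (c \<odot>\<^bsub>M\<^esub> g)"
proof -
  interpret W: abelian_subgroup W M using submodule_abelian_subgroup[OF W] .
  have "W +>\<^bsub>M\<^esub> (c \<odot>\<^bsub>M\<^esub> x) = W +>\<^bsub>M\<^esub> (c \<odot>\<^bsub>M\<^esub> g)" if x: "x \<in> W +>\<^bsub>M\<^esub> g" for x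
  proof -
    from x obtain w where w: "w \<in> W" "x = w \<oplus>\<^bsub>M\<^esub> g" by (auto simp: a_r_coset_def')
    then have "c \<odot>\<^bsub>M\<^esub> x = c \<odot>\<^bsub>M\<^esub> w \<oplus>\<^bsub>M\<^esub> c \<odot>\<^bsub>M\<^esub> g"
      using c g W.a_subset smult_r_distr by auto
    moreover have "c \<odot>\<^bsub>M\<^esub> w \<in> W" using submoduleE(4)[OF W c w(1)] .
    ultimately have "c \<odot>\<^bsub>M\<^esub> x \<in> W +>\<^bsub>M\<^esub> (c \<odot>\<^bsub>M\<^esub> g)" by (auto simp: a_r_coset_def')
    then show ?thesis using W.a_repr_independence' c g by auto
  qed
  then have "(\<Union>x\<in>W +>\<^bsub>M\<^esub> g. W +>\<^bsub>M\<^esub> (c \<odot>\<^bsub>M\<^esub> x)) = (\<Union>x\<in>W +>\<^bsub>M\<^esub> g. W +>\<^bsub>M\<^esub> (c \<odot>\<^bsub>M\<^esub> g))"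
    by (rule SUP_cong[OF refl])
  moreover have "W +>\<^bsub>M\<^esub> g \<noteq> {}" using W.a_rcos_self[OF g] by blast
  ultimately show ?thesis unfolding quot_module_def by simp
qed

lemma (in Module.module) quot_module_add:
  assumes W: "submodule W R M" and "g \<in> carrier M" "h \<in> carrier M"
  shows "(W +>\<^bsub>M\<^esub> g) \<oplus>\<^bsub>quot_module M W\<^esub> (W +>\<^bsub>M\<^esub> h) = W +>\<^bsub>M\<^esub> (g \<oplus>\<^bsub>M\<^esub> h)"
  using abelian_subgroup.a_rcos_sum[OF submodule_abelian_subgroup[OF W]] assms
  by (simp add: quot_module_def)

lemma quot_module_carrier: "carrier (quot_module M W) = (\<lambda>g. W +>\<^bsub>M\<^esub> g) ` carrier M"
  by (auto simp: quot_module_def A_RCOSETS_def' )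

lemma (in Module.module) quot_module_is_module:
  assumes W: "submodule W R M"
  shows "Module.module R (quot_module M W)"
proof -
  interpret W: abelian_subgroup W M using submodule_abelian_subgroup[OF W] .
  note Q = quot_module_carrier quot_module_add[OF W] quot_module_smult[OF W]
  have zero: "\<zero>\<^bsub>quot_module M W\<^esub> = W +>\<^bsub>M\<^esub> \<zero>\<^bsub>M\<^esub>"
    using a_coset_add_zero[OF W.a_subset] by (simp add: quot_module_def)
  have ab: "abelian_group (quot_module M W)"
  proof (rule abelian_groupI)
    fix x assume "x \<in> carrier (quot_module M W)"
    then obtain g where g: "g \<in> carrier M" "x = W +>\<^bsub>M\<^esub> g" by (auto simp: Q)
    then have "(W +>\<^bsub>M\<^esub> (\<ominus>\<^bsub>M\<^esub> g)) \<oplus>\<^bsub>quot_module M W\<^esub> x = \<zero>\<^bsub>quot_module M W\<^esub>"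
      by (simp add: Q zero M.l_neg)
    then show "\<exists>y\<in>carrier (quot_module M W). y \<oplus>\<^bsub>quot_module M W\<^esub> x = \<zero>\<^bsub>quot_module M W\<^esub>"
      using g by (auto simp: quot_module_carrier)
  qed (auto simp: Q zero M.a_ac)
  show ?thesis
  proof (rule moduleI[OF R.is_cring ab])
    fix a x assume "a \<in> carrier R" "x \<in> carrier (quot_module M W)"
    then show "a \<odot>\<^bsub>quot_module M W\<^esub> x \<in> carrier (quot_module M W)"
      by (auto simp: quot_module_carrier quot_module_smult[OF W])
  next
    fix a b x assume "a \<in> carrier R" "b \<in> carrier R" "x \<in> carrier (quot_module M W)"
    then show "(a \<oplus>\<^bsub>R\<^esub> b) \<odot>\<^bsub>quot_module M W\<^esub> x
        = a \<odot>\<^bsub>quot_module M W\<^esub> x \<oplus>\<^bsub>quot_module M W\<^esub> b \<odot>\<^bsub>quot_module M W\<^esub> x"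
      by (auto simp: quot_module_carrier quot_module_smult[OF W] quot_module_add[OF W] smult_l_distr)
  next
    fix a x y
    assume "a \<in> carrier R" "x \<in> carrier (quot_module M W)" "y \<in> carrier (quot_module M W)"
    then show "a \<odot>\<^bsub>quot_module M W\<^esub> (x \<oplus>\<^bsub>quot_module M W\<^esub> y)
        = a \<odot>\<^bsub>quot_module M W\<^esub> x \<oplus>\<^bsub>quot_module M W\<^esub> a \<odot>\<^bsub>quot_module M W\<^esub> y"
      by (auto simp: quot_module_carrier quot_module_smult[OF W] quot_module_add[OF W] smult_r_distr)
  next
    fix a b x assume "a \<in> carrier R" "b \<in> carrier R" "x \<in> carrier (quot_module M W)"
    then show "(a \<otimes>\<^bsub>R\<^esub> b) \<odot>\<^bsub>quot_module M W\<^esub> x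
        = a \<odot>\<^bsub>quot_module M W\<^esub> (b \<odot>\<^bsub>quot_module M W\<^esub> x)"
      by (auto simp: quot_module_carrier quot_module_smult[OF W] smult_assoc1)
  next
    fix x assume "x \<in> carrier (quot_module M W)"
    then show "\<one>\<^bsub>R\<^esub> \<odot>\<^bsub>quot_module M W\<^esub> x = x"
      by (auto simp: quot_module_carrier quot_module_smult[OF W])
  qed
qed

text \<open>A submodule of the quotient that contains the classes of a given set pulls back to a submodule
  that contains this set together with \<open>W\<close>. This turns a statement about generators of the quotient
  into one about submodules of \<open>M\<close> containing \<open>W\<close>.\<close>
lemma (in Module.module) quot_module_preimage_submodule:
  assumes W: "submodule W R M" and N: "submodule N R (quot_module M W)"
  shows "submodule {g \<in> carrier M. W +>\<^bsub>M\<^esub> g \<in> N} R M"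
    and "W \<subseteq> {g \<in> carrier M. W +>\<^bsub>M\<^esub> g \<in> N}"
proof -
  interpret W: abelian_subgroup W M using submodule_abelian_subgroup[OF W] .
  interpret Q: Module.module R "quot_module M W" by (rule quot_module_is_module[OF W])
  have zero: "W \<in> N"
    using subgroup.one_closed[OF submodule.axioms(1)[OF N]] by (simp add: quot_module_def)
  have smult: "W +>\<^bsub>M\<^esub> (a \<odot>\<^bsub>M\<^esub> g) \<in> N" if "a \<in> carrier R" "g \<in> carrier M" "W +>\<^bsub>M\<^esub> g \<in> N" for a g
    using Q.submoduleE(4)[OF N that(1,3)] by (simp add: quot_module_smult[OF W] that)
  show "W \<subseteq> {g \<in> carrier M. W +>\<^bsub>M\<^esub> g \<in> N}"
    using zero W.a_subset a_coset_join2[OF _ submodule.axioms(1)[OF W]] by auto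
  show "submodule {g \<in> carrier M. W +>\<^bsub>M\<^esub> g \<in> N} R M"
  proof (rule submoduleI)
    show "\<zero>\<^bsub>M\<^esub> \<in> {g \<in> carrier M. W +>\<^bsub>M\<^esub> g \<in> N}"
      using zero a_coset_add_zero W.a_subset by simp
  next
    fix a assume a: "a \<in> {g \<in> carrier M. W +>\<^bsub>M\<^esub> g \<in> N}"
    have "\<ominus>\<^bsub>M\<^esub> a = (\<ominus>\<^bsub>R\<^esub> \<one>\<^bsub>R\<^esub>) \<odot>\<^bsub>M\<^esub> a" using a by (simp add: smult_l_minus)
    then show "\<ominus>\<^bsub>M\<^esub> a \<in> {g \<in> carrier M. W +>\<^bsub>M\<^esub> g \<in> N}"
      using smult[of "\<ominus>\<^bsub>R\<^esub> \<one>\<^bsub>R\<^esub>" a] a by simp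
  next
    fix a b assume "a \<in> {g \<in> carrier M. W +>\<^bsub>M\<^esub> g \<in> N}" "b \<in> {g \<in> carrier M. W +>\<^bsub>M\<^esub> g \<in> N}"
    then show "a \<oplus>\<^bsub>M\<^esub> b \<in> {g \<in> carrier M. W +>\<^bsub>M\<^esub> g \<in> N}"
      using Q.submoduleE(5)[OF N, of "W +>\<^bsub>M\<^esub> a" "W +>\<^bsub>M\<^esub> b"] by (auto simp: quot_module_add[OF W])
  qed (use smult in auto)
qed

section \<open>Quotients of complex polynomials and their orders\<close>

text \<open>Divisibility of complex polynomials is inclusion of their multisets of roots, since both
  split into linear factors.\<close>
lemma poly_dvd_of_order_le:
  fixes p q :: "complex poly"
  assumes "p \<noteq> 0" "q \<noteq> 0" and le: "\<And>z. Polynomial.order z p \<le> Polynomial.order z q"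
  shows "p dvd q"
proof -
  have "proots p \<subseteq># proots q" using assms by (intro mset_subset_eqI) simp
  then obtain X where X: "proots q = proots p + X" by (auto simp: mset_subset_eq_exists_conv)
  have "(\<Prod>x\<in>#proots p. [:-x, 1:]) dvd (\<Prod>x\<in>#proots q. [:-x, 1:])"
    unfolding X by simp
  then have "Polynomial.smult (lead_coeff p) (\<Prod>x\<in>#proots p. [:-x, 1:])
      dvd Polynomial.smult (lead_coeff q) (\<Prod>x\<in>#proots q. [:-x, 1:])"
    using assms by (simp add: smult_dvd_iff dvd_smult)
  then show ?thesis by (simp add: complex_poly_decompose_multiset)
qed

lemma zorder_poly_quotient:
  fixes p q :: "complex poly"
  assumes "p \<noteq> 0" "q \<noteq> 0"
  shows "zorder (\<lambda>x. poly p x / poly q x) z = int (Polynomial.order z p) - int (Polynomial.order z q)"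
proof -
  obtain p1 where p1: "p = [:-z, 1:] ^ Polynomial.order z p * p1" "\<not> [:-z, 1:] dvd p1"
    using order_decomp[OF assms(1)] by blast
  obtain q1 where q1: "q = [:-z, 1:] ^ Polynomial.order z q * q1" "\<not> [:-z, 1:] dvd q1"
    using order_decomp[OF assms(2)] by blast
  let ?m = "Polynomial.order z p" and ?l = "Polynomial.order z q"
  show ?thesis
  proof (rule zorder_eqI)
    show "open {x. poly q1 x \<noteq> 0}"
      by (intro open_Collect_neq continuous_intros)
    show "z \<in> {x. poly q1 x \<noteq> 0}" using q1(2) by (simp add: poly_eq_0_iff_dvd)
    show "(\<lambda>x. poly p1 x / poly q1 x) holomorphic_on {x. poly q1 x \<noteq> 0}"
      by (intro holomorphic_intros) auto
    show "poly p1 z / poly q1 z \<noteq> 0" using p1(2) q1(2) by (simp add: poly_eq_0_iff_dvd)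
  next
    fix w assume w: "w \<in> {x. poly q1 x \<noteq> 0}" "w \<noteq> z"
    have "poly p w = (w - z) ^ ?m * poly p1 w"
      by (subst p1(1)) simp
    moreover have "poly q w = (w - z) ^ ?l * poly q1 w"
      by (subst q1(1)) simp
    ultimately show "poly p w / poly q w = poly p1 w / poly q1 w * (w - z) powi (int ?m - int ?l)"
      using w by (simp add: power_int_diff mult_ac)
  qed
qed

text \<open>The reflected polynomials are the expressions of \<open>p\<close> and \<open>q\<close> in the local coordinate \<open>w = 1 / x\<close>
  at infinity, up to powers of \<open>w\<close>; they do not vanish at \<open>w = 0\<close>.\<close>
lemma zorder_poly_quotient_infinity:
  fixes p q :: "complex poly"
  assumes "p \<noteq> 0" "q \<noteq> 0"
  shows "zorder (\<lambda>w. poly p (inverse w) / poly q (inverse w)) 0 = int (degree q) - int (degree p)"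
proof (rule zorder_eqI)
  show "open {x. poly (reflect_poly q) x \<noteq> 0}"
    by (intro open_Collect_neq continuous_intros)
  show "0 \<in> {x. poly (reflect_poly q) x \<noteq> 0}" using assms by simp
  show "(\<lambda>x. poly (reflect_poly p) x / poly (reflect_poly q) x)
      holomorphic_on {x. poly (reflect_poly q) x \<noteq> 0}"
    by (intro holomorphic_intros) auto
  show "poly (reflect_poly p) 0 / poly (reflect_poly q) 0 \<noteq> 0" using assms by simp
next
  fix w :: complex assume w: "w \<in> {x. poly (reflect_poly q) x \<noteq> 0}" "w \<noteq> 0"
  then show "poly p (inverse w) / poly q (inverse w)
      = poly (reflect_poly p) w / poly (reflect_poly q) w * (w - 0) powi (int (degree q) - int (degree p))"
    by (simp add: poly_reflect_poly_nz power_int_diff)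
qed

lemma is_pole_poly_quotient:
  fixes p q :: "complex poly"
  assumes "p \<noteq> 0" "q \<noteq> 0" and less: "Polynomial.order z p < Polynomial.order z q"
  shows "is_pole (\<lambda>x. poly p x / poly q x) z"
proof -
  obtain p1 where p1: "p = [:-z, 1:] ^ Polynomial.order z p * p1" "\<not> [:-z, 1:] dvd p1"
    using order_decomp[OF assms(1)] by blast
  obtain q1 where q1: "q = [:-z, 1:] ^ Polynomial.order z q * q1" "\<not> [:-z, 1:] dvd q1"
    using order_decomp[OF assms(2)] by blast
  let ?m = "Polynomial.order z p" and ?l = "Polynomial.order z q"
  have "is_pole (\<lambda>x. (poly p1 x / poly q1 x) / (x - z) ^ (?l - ?m)) z"
  proof (rule is_pole_basic)
    show "(\<lambda>x. poly p1 x / poly q1 x) holomorphic_on {x. poly q1 x \<noteq> 0}"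
      by (intro holomorphic_intros) auto
    show "open {x. poly q1 x \<noteq> 0}"
      by (intro open_Collect_neq continuous_intros)
    show "z \<in> {x. poly q1 x \<noteq> 0}" using q1(2) by (simp add: poly_eq_0_iff_dvd)
    show "poly p1 z / poly q1 z \<noteq> 0" using p1(2) q1(2) by (simp add: poly_eq_0_iff_dvd)
    show "0 < ?l - ?m" using less by simp
  qed
  moreover have "\<forall>\<^sub>F w in at z. (poly p1 w / poly q1 w) / (w - z) ^ (?l - ?m) = poly p w / poly q w"
    unfolding eventually_at_filter
  proof (intro always_eventually allI impI)
    fix w assume w: "w \<noteq> z"
    have "poly p w = (w - z) ^ ?m * poly p1 w" by (subst p1(1)) simp
    moreover have "poly q w = (w - z) ^ (?m + (?l - ?m)) * poly q1 w"
      using less by (subst q1(1)) simp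
    ultimately show "(poly p1 w / poly q1 w) / (w - z) ^ (?l - ?m) = poly p w / poly q w"
      using w by (simp add: power_add mult_ac)
  qed
  ultimately show ?thesis by (rule is_pole_transform) simp
qed

section \<open>Polynomials and rational functions over a subfield\<close>

locale complex_subfield =
  fixes k :: "complex set"
  assumes field: "field (complex_subring k)"
begin

lemma zero_closed [simp, intro]: "0 \<in> k"
  and one_closed [simp, intro]: "1 \<in> k"
  and add_closed [simp, intro]: "a \<in> k \<Longrightarrow> b \<in> k \<Longrightarrow> a + b \<in> k"
  and mult_closed [simp, intro]: "a \<in> k \<Longrightarrow> b \<in> k \<Longrightarrow> a * b \<in> k"
proof -
  interpret field "complex_subring k" by (rule field)
  show "0 \<in> k" "1 \<in> k" using zero_closed one_closed by (simp_all add: complex_subring_def)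
  show "a + b \<in> k" "a * b \<in> k" if "a \<in> k" "b \<in> k"
    using that a_closed[of a b] m_closed[of a b] by (simp_all add: complex_subring_def)
qed

lemma uminus_closed [simp, intro]: assumes "a \<in> k" shows "- a \<in> k"
proof -
  interpret field "complex_subring k" by (rule field)
  obtain b where "b \<in> k" "b + a = 0"
    using l_neg[of a] a_inv_closed[of a] assms by (auto simp: complex_subring_def)
  then show ?thesis by (metis add_eq_0_iff2 minus_minus)
qed

lemma inverse_closed [simp, intro]: assumes "a \<in> k" shows "inverse a \<in> k"
proof (cases "a = 0")
  case False
  interpret field "complex_subring k" by (rule field)
  have "a \<in> Units (complex_subring k)"
    using False assms by (simp add: field_Units) (simp add: complex_subring_def)
  then obtain b where "b \<in> k" "b * a = 1"
    by (auto simp: Units_def complex_subring_def)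
  then show ?thesis by (metis inverse_unique mult.commute)
qed simp

lemma diff_closed [simp, intro]: "a \<in> k \<Longrightarrow> b \<in> k \<Longrightarrow> a - b \<in> k"
  using add_closed[of a "- b"] by simp

lemma divide_closed [simp, intro]: "a \<in> k \<Longrightarrow> b \<in> k \<Longrightarrow> a / b \<in> k"
  by (simp add: divide_inverse)

lemma of_nat_closed [simp, intro]: "of_nat m \<in> k"
  by (induction m) auto

lemma power_closed [simp, intro]: "a \<in> k \<Longrightarrow> a ^ m \<in> k"
  by (induction m) auto

lemma sum_closed [intro]: "(\<And>x. x \<in> X \<Longrightarrow> g x \<in> k) \<Longrightarrow> sum g X \<in> k"
  by (induction X rule: infinite_finite_induct) auto

abbreviation "kx \<equiv> poly_over k"

lemma poly_over_0 [simp]: "0 \<in> kx"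
  by (simp add: poly_over_def)

lemma poly_over_pCons [simp]: "pCons a q \<in> kx \<longleftrightarrow> a \<in> k \<and> q \<in> kx"
  unfolding poly_over_def mem_Collect_eq by (metis coeff_pCons_0 coeff_pCons_Suc not0_implies_Suc)

lemma poly_over_1 [simp]: "1 \<in> kx"
  by (simp add: one_pCons)

lemma poly_over_add [simp, intro]: "p \<in> kx \<Longrightarrow> q \<in> kx \<Longrightarrow> p + q \<in> kx"
  and poly_over_uminus [simp, intro]: "p \<in> kx \<Longrightarrow> - p \<in> kx"
  and poly_over_diff [simp, intro]: "p \<in> kx \<Longrightarrow> q \<in> kx \<Longrightarrow> p - q \<in> kx"
  and poly_over_smult [simp, intro]: "c \<in> k \<Longrightarrow> p \<in> kx \<Longrightarrow> Polynomial.smult c p \<in> kx"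
  and poly_over_mult [simp, intro]: "p \<in> kx \<Longrightarrow> q \<in> kx \<Longrightarrow> p * q \<in> kx"
  and poly_over_pderiv [simp, intro]: "p \<in> kx \<Longrightarrow> pderiv p \<in> kx"
  and poly_over_monom [simp, intro]: "c \<in> k \<Longrightarrow> Polynomial.monom c m \<in> kx"
  by (auto simp: poly_over_def coeff_mult coeff_pderiv intro!: sum_closed simp del: of_nat_Suc)

lemma poly_over_power [simp, intro]: "p \<in> kx \<Longrightarrow> p ^ m \<in> kx"
  by (induction m) auto

lemma poly_over_prod [intro]: "(\<And>x. x \<in> X \<Longrightarrow> g x \<in> kx) \<Longrightarrow> prod g X \<in> kx"
  by (induction X rule: infinite_finite_induct) auto

lemma poly_over_sum [intro]: "(\<And>x. x \<in> X \<Longrightarrow> g x \<in> kx) \<Longrightarrow> sum g X \<in> kx"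
  by (induction X rule: infinite_finite_induct) auto

lemma poly_in_field: "p \<in> kx \<Longrightarrow> z \<in> k \<Longrightarrow> poly p z \<in> k"
  by (induction p) auto

text \<open>Long division: the leading coefficient of \<open>a\<close> is the quotient of those of \<open>a * b\<close> and \<open>b\<close>, hence
  lies in \<open>k\<close>, and subtracting the leading term of \<open>a\<close> lowers the degree.\<close>
lemma poly_over_cancel:
  assumes "a * b \<in> kx" "b \<in> kx" "b \<noteq> 0"
  shows "a \<in> kx"
  using assms(1)
proof (induction "degree a" arbitrary: a rule: less_induct)
  case less
  have "lead_coeff a * lead_coeff b \<in> k" "lead_coeff b \<in> k"
    using less.prems assms(2) lead_coeff_mult[of a b] unfolding poly_over_def mem_Collect_eq by metis+
  then have lc: "lead_coeff a \<in> k"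
    using divide_closed[of "lead_coeff a * lead_coeff b" "lead_coeff b"] assms(3) by simp
  let ?m = "Polynomial.monom (lead_coeff a) (degree a)"
  define a' where "a' = a - ?m"
  have "degree a' \<le> degree a" unfolding a'_def
    by (intro degree_diff_le degree_monom_le) simp
  moreover have "coeff a' (degree a) = 0" by (simp add: a'_def)
  ultimately have "a' = 0 \<or> degree a' < degree a" by (rule eq_zero_or_degree_less)
  moreover have "a' * b \<in> kx"
    unfolding a'_def left_diff_distrib
    by (rule poly_over_diff[OF less.prems poly_over_mult[OF poly_over_monom[OF lc] assms(2)]])
  ultimately have "a' \<in> kx" using less.hyps by auto
  then have "a' + ?m \<in> kx" using lc by (intro poly_over_add poly_over_monom)
  then show ?case by (simp add: a'_def)
qed

end

definition vanishing_poly :: "complex set \<Rightarrow> complex poly" where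
  "vanishing_poly T = (\<Prod>t\<in>T. [:- t, 1:])"

lemma poly_vanishing_poly_eq_0_iff: "finite T \<Longrightarrow> poly (vanishing_poly T) z = 0 \<longleftrightarrow> z \<in> T"
  by (auto simp: vanishing_poly_def poly_prod)

lemma vanishing_poly_nonzero [simp]: "finite T \<Longrightarrow> vanishing_poly T \<noteq> 0"
  by (auto simp: vanishing_poly_def)

lemma degree_vanishing_poly: "degree (vanishing_poly T) = card T"
  unfolding vanishing_poly_def by (subst degree_prod_sum_eq) auto

lemma lead_coeff_vanishing_poly: "lead_coeff (vanishing_poly T) = 1"
  unfolding vanishing_poly_def by (simp add: lead_coeff_prod)

lemma vanishing_poly_remove:
  "finite T \<Longrightarrow> t \<in> T \<Longrightarrow> vanishing_poly T = [:- t, 1:] * vanishing_poly (T - {t})"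
  unfolding vanishing_poly_def by (rule prod.remove)

lemma order_vanishing_poly_power:
  assumes "finite T" "z \<in> T"
  shows "m \<le> Polynomial.order z (vanishing_poly T ^ m)"
proof -
  have "[:- z, 1:] ^ m dvd vanishing_poly T ^ m"
    unfolding vanishing_poly_remove[OF assms] by (intro dvd_power_same dvd_triv_left)
  then show ?thesis using assms by (simp add: order_divides)
qed

lemma vanishing_poly_dvd:
  assumes "finite T" "\<And>t. t \<in> T \<Longrightarrow> poly p t = 0"
  shows "vanishing_poly T dvd p"
  using assms
proof (induction T arbitrary: p)
  case (insert t T)
  obtain q where q: "p = [:- t, 1:] * q" using insert.prems[of t] by (auto simp: poly_eq_0_iff_dvd)
  have "poly q s = 0" if "s \<in> T" for s
    using insert.prems[of s] insert.hyps that q by auto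
  then have "vanishing_poly T dvd q" by (rule insert.IH)
  then show ?case using insert.hyps unfolding q vanishing_poly_def by (simp add: mult_dvd_mono del: mult_pCons_left)
qed (simp add: vanishing_poly_def)

text \<open>Bounding every multiplicity by the degree gives one exponent that works for all roots.\<close>
lemma dvd_vanishing_poly_power:
  assumes "finite T" "b \<noteq> 0" "\<And>z. poly b z = 0 \<Longrightarrow> z \<in> T"
  shows "b dvd vanishing_poly T ^ degree b"
proof (rule poly_dvd_of_order_le)
  fix z
  show "Polynomial.order z b \<le> Polynomial.order z (vanishing_poly T ^ degree b)"
  proof (cases "z \<in> T")
    case True
    then show ?thesis using order_degree[OF assms(2), of z] order_vanishing_poly_power[OF assms(1) True, of "degree b"] by linarith
  next
    case False
    then show ?thesis using assms order_0I[of b z] by (metis zero_le)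
  qed
qed (use assms in auto)

context complex_subfield
begin

lemma vanishing_poly_over: "T \<subseteq> k \<Longrightarrow> vanishing_poly T \<in> kx"
  unfolding vanishing_poly_def by (intro poly_over_prod) auto

text \<open>The value at a pole is lost on passing to a fraction with denominator a power of \<open>vanishing_poly T\<close>,
  so the two sides can only be compared off \<open>T\<close>. Since the given fraction is reduced, every root of its
  denominator is a pole.\<close>
lemma rational_function_as_fraction:
  assumes T: "finite T" "T \<subseteq> k" and q: "q \<in> rational_functions_poles k T"
  obtains P N where "P \<in> kx" "\<And>x. x \<notin> T \<Longrightarrow> q x = poly P x / poly (vanishing_poly T) x ^ N"
proof -
  from q obtain a b where ab: "a \<in> kx" "b \<in> kx" "b \<noteq> 0" "coprime a b"
    and q_eq: "q = (\<lambda>x. poly a x / poly b x)" and poles: "{z. is_pole q z} \<subseteq> T"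
    unfolding rational_functions_poles_def rational_functions_def by auto
  have roots: "z \<in> T" if z: "poly b z = 0" for z
  proof -
    have az: "poly a z \<noteq> 0"
      \<comment> \<open>otherwise \<open>x - z\<close> would be a common factor of numerator and denominator\<close>
      using ab(4) z coprime_common_divisor[of a b "[:- z, 1:]"]
      by (auto simp: poly_eq_0_iff_dvd is_unit_iff_degree)
    then have "Polynomial.order z a < Polynomial.order z b" "a \<noteq> 0"
      using z ab(3) order_root[of b z] order_0I[of a z] by auto
    then have "is_pole q z" unfolding q_eq using ab(3) by (intro is_pole_poly_quotient)
    then show ?thesis using poles by blast
  qed
  let ?R = "vanishing_poly T ^ degree b"
  obtain c where c: "?R = b * c" using dvd_vanishing_poly_power[OF T(1) ab(3) roots] by blast
  have R: "?R \<in> kx" using vanishing_poly_over[OF T(2)] by auto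
  have "c \<in> kx" using R ab(2,3) by (intro poly_over_cancel[of c b]) (simp_all add: c mult.commute)
  moreover have "q x = poly (a * c) x / poly (vanishing_poly T) x ^ degree b" if "x \<notin> T" for x
  proof -
    have "poly (vanishing_poly T) x ^ degree b = poly b x * poly c x" using arg_cong[OF c, of "\<lambda>p. poly p x"] by simp
    moreover have "poly (vanishing_poly T) x \<noteq> 0" using that poly_vanishing_poly_eq_0_iff[OF T(1)] by simp
    ultimately show ?thesis unfolding q_eq by auto
  qed
  ultimately show ?thesis using that ab(1) by blast
qed

text \<open>Reducing the fraction stays within \<open>k\<close>: a common factor of \<open>P\<close> and \<open>b\<close> has a complex root, and
  this root lies in \<open>T\<close>, hence in \<open>k\<close>.\<close>
lemma fraction_as_rational_function:
  assumes "T \<subseteq> k" "P \<in> kx" "b \<in> kx" "b \<noteq> 0" and "\<And>z. poly b z = 0 \<Longrightarrow> z \<in> T"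
  shows "\<exists>q\<in>rational_functions_poles k T. \<forall>x. x \<notin> T \<longrightarrow> q x = poly P x / poly b x"
  using assms(2-)
proof (induction "degree b" arbitrary: P b rule: less_induct)
  case less
  show ?case
  proof (cases "coprime P b")
    case True
    have "z \<in> T" if "is_pole (\<lambda>x. poly P x / poly b x) z" for z
    proof (rule ccontr)
      assume "z \<notin> T"
      then have "z \<in> {x. poly b x \<noteq> 0}" using less.prems by auto
      moreover have "open {x. poly b x \<noteq> 0}" by (intro open_Collect_neq continuous_intros)
      moreover have "(\<lambda>x. poly P x / poly b x) holomorphic_on {x. poly b x \<noteq> 0}"
        by (intro holomorphic_intros) auto
      ultimately show False using that not_is_pole_holomorphic by blast
    qed
    then have "(\<lambda>x. poly P x / poly b x) \<in> rational_functions_poles k T"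
      using True less.prems unfolding rational_functions_poles_def rational_functions_def by blast
    then show ?thesis by (intro bexI) auto
  next
    case False
    then obtain d where d: "d dvd P" "d dvd b" "\<not> is_unit d" by (auto simp: coprime_def)
    have "d \<noteq> 0" using d(2) less.prems by auto
    then have "degree d \<noteq> 0" using d(3) by (simp add: is_unit_iff_degree)
    then obtain z where "poly d z = 0"
      using fundamental_theorem_of_algebra constant_degree by metis
    then have "[:- z, 1:] dvd P" "[:- z, 1:] dvd b" using d(1,2) by (auto simp: poly_eq_0_iff_dvd intro: dvd_trans)
    then obtain P1 b1 where P1: "P = P1 * [:- z, 1:]" and b1: "b = b1 * [:- z, 1:]"
      by (metis dvdE mult.commute)
    have z: "z \<in> T" using less.prems(4)[of z] b1 by auto
    have lin: "[:- z, 1:] \<in> kx" using z assms(1) by auto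
    have "P1 \<in> kx" by (rule poly_over_cancel[OF _ lin]) (use less.prems(1) P1 in auto)
    moreover have "b1 \<in> kx" by (rule poly_over_cancel[OF _ lin]) (use less.prems(2) b1 in auto)
    moreover have "b1 \<noteq> 0" using less.prems(3) b1 by auto
    moreover have "degree b1 < degree b" using \<open>b1 \<noteq> 0\<close> unfolding b1 by (subst degree_mult_eq) auto
    moreover have "w \<in> T" if "poly b1 w = 0" for w using less.prems(4)[of w] that b1 by auto
    ultimately obtain q where "q \<in> rational_functions_poles k T"
      and q: "\<forall>x. x \<notin> T \<longrightarrow> q x = poly P1 x / poly b1 x"
      using less.hyps[of b1 P1] by blast
    moreover have "q x = poly P x / poly b x" if "x \<notin> T" for x
    proof -
      have "x - z \<noteq> 0" using that z by auto
      moreover have "poly P x = poly P1 x * (x - z)" "poly b x = poly b1 x * (x - z)"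
        by (simp_all add: P1 b1 algebra_simps)
      ultimately show ?thesis using q that by simp
    qed
    ultimately show ?thesis by blast
  qed
qed

text \<open>Regularity at the finite points bounds the multiplicity of each root of \<open>p 0\<close> by that of
  \<open>p i * R ^ i\<close>, which gives the divisibility; regularity at infinity is the bound on the degree. The
  inequality is written with \<open>degree A + i\<close> because \<open>i * card T - i\<close> would be truncated if \<open>T\<close> is empty.\<close>
lemma fuchsian_coefficient:
  assumes T: "finite T" "T \<subseteq> k" and "p i \<in> kx" "p 0 \<in> kx" "p 0 \<noteq> 0"
    and fuchs: "fuchsian n p" and i: "i \<in> {1..n}" and sing: "finite_singularities n p \<subseteq> T"
  shows "\<exists>A\<in>kx. p i * vanishing_poly T ^ i = A * p 0 \<and> (A = 0 \<or> degree A + i \<le> i * card T)"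
proof (cases "p i = 0")
  case False
  let ?R = "vanishing_poly T"
  have quot: "normalized_coeff p i = (\<lambda>x. poly (p i) x / poly (p 0) x)"
    by (simp add: fun_eq_iff normalized_coeff_def)
  have finite_orders: "- int i \<le> int (Polynomial.order z (p i)) - int (Polynomial.order z (p 0))" for z
  proof -
    have "- int i \<le> zorder (normalized_coeff p i) z"
      using fuchs i False unfolding fuchsian_def by blast
    then show ?thesis unfolding quot using zorder_poly_quotient[OF False assms(5), of z] by simp
  qed
  have "int i \<le> zorder (\<lambda>w. normalized_coeff p i (inverse w)) 0"
    using fuchs i False unfolding fuchsian_def by blast
  then have deg: "int i \<le> int (degree (p 0)) - int (degree (p i))"
    unfolding quot using zorder_poly_quotient_infinity[OF False assms(5)] by simp
  have R0: "?R ^ i \<noteq> 0" using T by simp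
  have "p 0 dvd p i * ?R ^ i"
  proof (rule poly_dvd_of_order_le)
    fix z
    have ord: "Polynomial.order z (p i * ?R ^ i) = Polynomial.order z (p i) + Polynomial.order z (?R ^ i)"
      using False R0 by (intro order_mult) auto
    show "Polynomial.order z (p 0) \<le> Polynomial.order z (p i * ?R ^ i)"
    proof (cases "z \<in> T")
      case True
      then show ?thesis
        using finite_orders[of z] order_vanishing_poly_power[OF T(1) True, of i] ord by linarith
    next
      case False
      then have "\<not> is_pole (normalized_coeff p i) z"
        using sing i unfolding finite_singularities_def by blast
      then show ?thesis
        using is_pole_poly_quotient[OF \<open>p i \<noteq> 0\<close> assms(5), of z] ord unfolding quot by linarith
    qed
  qed (use False R0 assms in auto)
  then obtain A where A: "p i * ?R ^ i = A * p 0" by (metis dvdE mult.commute)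
  have "A \<in> kx"
    by (rule poly_over_cancel[of A "p 0"])
      (use assms A[symmetric] vanishing_poly_over[OF T(2)] in auto)
  moreover have "A \<noteq> 0" using A False R0 by auto
  moreover have "degree A + degree (p 0) = degree (p i) + i * card T"
    using arg_cong[OF A, of degree] False R0 \<open>A \<noteq> 0\<close> assms(5)
    by (simp add: degree_mult_eq degree_power_eq degree_vanishing_poly T)
  ultimately show ?thesis using A deg by (intro bexI[of _ A]) auto
qed auto

end

section \<open>Derivatives of fractions with fixed poles and the adjoint operator\<close>

text \<open>The numerator of the derivative of \<open>P / R ^ N\<close> over the denominator \<open>R ^ (N + 1)\<close>. Keeping the
  denominators as powers of \<open>R\<close> reduces all estimates of pole orders and degrees to values and
  leading coefficients of polynomials.\<close>
definition quotient_deriv :: "complex poly \<Rightarrow> nat \<Rightarrow> complex poly \<Rightarrow> complex poly" where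
  "quotient_deriv R N P = pderiv P * R - Polynomial.smult (of_nat N) (P * pderiv R)"

text \<open>The numerator of the \<open>m\<close>-th derivative of \<open>P / R ^ N\<close> over \<open>R ^ (N + m)\<close>. Differentiating first and
  then recursing with \<open>N + 1\<close> matches the order in which integration by parts proceeds.\<close>
primrec quotient_higher_deriv :: "complex poly \<Rightarrow> nat \<Rightarrow> nat \<Rightarrow> complex poly \<Rightarrow> complex poly" where
  "quotient_higher_deriv R 0 N P = P"
| "quotient_higher_deriv R (Suc m) N P = quotient_higher_deriv R m (Suc N) (quotient_deriv R N P)"

lemma quotient_deriv_at_root:
  "poly R t = 0 \<Longrightarrow> poly (quotient_deriv R N P) t = - of_nat N * poly P t * poly (pderiv R) t"
  by (simp add: quotient_deriv_def)

lemma quotient_higher_deriv_at_root: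
  assumes "poly R t = 0"
  shows "poly (quotient_higher_deriv R m N P) t
    = (- poly (pderiv R) t) ^ m * pochhammer (of_nat N) m * poly P t"
proof (induction m arbitrary: N P)
  case (Suc m)
  then show ?case
    using quotient_deriv_at_root[OF assms] by (simp add: pochhammer_rec algebra_simps)
qed simp

lemma coeff_mult_degree_bound:
  fixes p q :: "'a::idom poly"
  assumes "degree p \<le> a" "degree q \<le> b"
  shows "coeff (p * q) (a + b) = coeff p a * coeff q b"
proof (cases "degree p = a \<and> degree q = b")
  case True
  then show ?thesis using coeff_mult_degree_sum[of p q] by simp
next
  case False
  then have less: "degree p < a \<or> degree q < b" using assms by auto
  then have "degree (p * q) < a + b" using assms degree_mult_le[of p q] by linarith
  then show ?thesis using less coeff_eq_0[of p a] coeff_eq_0[of q b] by (auto simp: coeff_eq_0)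
qed

text \<open>At infinity \<open>P / R ^ N\<close> behaves like a multiple of \<open>x\<close> to the power \<open>d - N * degree R\<close>, which
  explains the factor. The exponent \<open>e = d + degree R - 1\<close> is introduced by \<open>Suc e = d + degree R\<close> to
  avoid truncated subtraction.\<close>
lemma quotient_deriv_leading:
  assumes "lead_coeff R = 1" "degree P \<le> d" "Suc e = d + degree R"
  shows "degree (quotient_deriv R N P) \<le> e"
    and "coeff (quotient_deriv R N P) e = (of_nat d - of_nat (N * degree R)) * coeff P d"
proof -
  have 1: "degree (pderiv P * R) \<le> e \<and> coeff (pderiv P * R) e = of_nat d * coeff P d"
  proof (cases d)
    case 0
    then have "pderiv P = 0" using assms(2) by (simp add: pderiv_eq_0_iff)
    then show ?thesis using 0 by simp
  next
    case (Suc d')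
    then have "degree (pderiv P) \<le> d'" "e = d' + degree R"
      using assms by (auto simp: degree_pderiv)
    then show ?thesis
      using coeff_mult_degree_bound[of "pderiv P" d' R "degree R"] degree_mult_le[of "pderiv P" R] assms(1) Suc
      by (simp add: coeff_pderiv)
  qed
  have 2: "degree (P * pderiv R) \<le> e \<and> coeff (P * pderiv R) e = of_nat (degree R) * coeff P d"
  proof (cases "degree R")
    case 0
    then show ?thesis by (simp add: pderiv_eq_0_iff[THEN iffD2])
  next
    case (Suc r')
    then have "degree (pderiv R) \<le> r'" "e = d + r'"
      using assms by (auto simp: degree_pderiv)
    moreover have "coeff (pderiv R) r' = of_nat (degree R)"
      using assms(1) Suc by (simp add: coeff_pderiv)
    ultimately show ?thesis
      using coeff_mult_degree_bound[of P d "pderiv R" r'] degree_mult_le[of P "pderiv R"] assms(2)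
      by simp
  qed
  show "degree (quotient_deriv R N P) \<le> e"
    unfolding quotient_deriv_def using 1 2 by (intro degree_diff_le) (auto intro: order_trans[OF degree_smult_le])
  show "coeff (quotient_deriv R N P) e = (of_nat d - of_nat (N * degree R)) * coeff P d"
    unfolding quotient_deriv_def using 1 2 by (simp add: algebra_simps)
qed

text \<open>The product is the falling factorial that arises from differentiating a power of \<open>x\<close>
  repeatedly; the exponent \<open>e = d + m * degree R - m\<close> is again given by an equation free of subtraction.\<close>
lemma quotient_higher_deriv_leading:
  assumes "lead_coeff R = 1" "degree P \<le> d" "e + m = d + m * degree R"
  shows "degree (quotient_higher_deriv R m N P) \<le> e
    \<and> coeff (quotient_higher_deriv R m N P) e
        = (\<Prod>j<m. of_nat d - of_nat (N * degree R) - of_nat j) * coeff P d"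
  using assms(2-)
proof (induction m arbitrary: N P d)
  case (Suc m)
  obtain d' where d': "Suc d' = d + degree R" using Suc.prems(2) by (cases "d + degree R") auto
  note lead = quotient_deriv_leading[OF assms(1) Suc.prems(1) d', of N]
  have "e + m = d' + m * degree R" using d' Suc.prems(2) by auto
  note IH = Suc.IH[OF lead(1) this, of "Suc N"]
  have "of_nat d' = of_nat d + of_nat (degree R) - (1::complex)"
    using arg_cong[OF d', of "of_nat :: nat \<Rightarrow> complex"] by (simp add: algebra_simps)
  then have "(\<Prod>j<m. of_nat d' - of_nat (Suc N * degree R) - of_nat j)
      = (\<Prod>j<m. of_nat d - of_nat (N * degree R) - of_nat (Suc j) :: complex)"
    by (intro prod.cong) (simp_all add: algebra_simps)
  then show ?case
    using IH lead(2) by (simp add: prod.lessThan_Suc_shift del: prod.lessThan_Suc of_nat_Suc of_nat_mult mult_Suc)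
qed simp

lemma degree_quotient_higher_deriv_le:
  assumes "lead_coeff R = 1" "degree R \<ge> 1"
  shows "degree (quotient_higher_deriv R m N P) \<le> degree P + m * (degree R - 1)"
proof (induction m arbitrary: N P)
  case (Suc m)
  have "degree (quotient_deriv R N P) \<le> degree P + (degree R - 1)"
    using assms by (intro quotient_deriv_leading(1)[OF assms(1) order_refl]) simp
  then show ?case using Suc[of "Suc N" "quotient_deriv R N P"] by simp
qed simp

text \<open>For the monic operator with coefficients \<open>A i / R ^ i\<close> this is the numerator of the adjoint
  operator applied to \<open>Q / R ^ M\<close>, over the denominator \<open>R ^ (M + n)\<close>.\<close>
definition adjoint_numerator ::
    "complex poly \<Rightarrow> (nat \<Rightarrow> complex poly) \<Rightarrow> nat \<Rightarrow> nat \<Rightarrow> complex poly \<Rightarrow> complex poly" where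
  "adjoint_numerator R A n M Q =
     (\<Sum>i\<le>n. Polynomial.smult ((-1) ^ (n - i)) (quotient_higher_deriv R (n - i) (M + i) (A i * Q)))"

lemma poly_falling_poly_eq_pochhammer:
  assumes "i \<le> n" "M \<ge> 1"
  shows "poly (falling_poly (n - i)) (of_nat (n - 1 + M)) = pochhammer (of_nat (M + i)) (n - i)"
proof -
  have "poly (falling_poly (n - i)) (of_nat (n - 1 + M)) = (\<Prod>j<n - i. of_nat (n - 1 + M) - of_nat j)"
    unfolding falling_poly_def poly_prod by (intro prod.cong) simp_all
  also have "\<dots> = (\<Prod>j<n - i. of_nat (M + i) + of_nat (n - i - Suc j) :: complex)"
  proof (rule prod.cong)
    fix j assume "j \<in> {..<n - i}"
    then have "n - 1 + M = (M + i) + (n - i - Suc j) + j" by auto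
    then show "of_nat (n - 1 + M) - of_nat j = (of_nat (M + i) + of_nat (n - i - Suc j) :: complex)"
      by (metis add_diff_cancel_right' of_nat_add)
  qed simp
  also have "\<dots> = (\<Prod>j<n - i. of_nat (M + i) + of_nat j :: complex)"
    by (rule prod.nat_diff_reindex)
  also have "\<dots> = pochhammer (of_nat (M + i)) (n - i)"
    by (simp add: pochhammer_prod atLeast0LessThan)
  finally show ?thesis .
qed

text \<open>At a simple root \<open>t\<close> of \<open>R\<close> the numerators of the derivatives of \<open>P / R ^ N\<close> take values that
  depend only on \<open>P t\<close> and \<open>R' t\<close>. The sum is the indicial polynomial at \<open>t\<close> evaluated at
  \<open>n - 1 + M\<close>: up to powers of \<open>R' t\<close> it is the factor by which the adjoint multiplies the leading
  coefficient of a pole of order \<open>M\<close>.\<close>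
lemma adjoint_numerator_at_root:
  assumes "poly R t = 0" "poly (pderiv R) t \<noteq> 0" "M \<ge> 1"
  shows "poly (adjoint_numerator R A n M Q) t = poly (pderiv R) t ^ n * poly Q t *
    (\<Sum>i\<le>n. poly (A i) t / poly (pderiv R) t ^ i * poly (falling_poly (n - i)) (of_nat (n - 1 + M)))"
proof -
  have "(-1) ^ (n - i) * poly (quotient_higher_deriv R (n - i) (M + i) (A i * Q)) t
      = poly (pderiv R) t ^ n * poly Q t * (poly (A i) t / poly (pderiv R) t ^ i
          * poly (falling_poly (n - i)) (of_nat (n - 1 + M)))" if "i \<le> n" for i
  proof -
    have "(-1) ^ (n - i) * (- poly (pderiv R) t) ^ (n - i) = poly (pderiv R) t ^ (n - i)"
      by (simp flip: power_mult_distrib)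
    moreover have "poly (pderiv R) t ^ n = poly (pderiv R) t ^ (n - i) * poly (pderiv R) t ^ i"
      using that by (simp flip: power_add)
    ultimately show ?thesis
      using assms(2) unfolding quotient_higher_deriv_at_root[OF assms(1)]
        poly_falling_poly_eq_pochhammer[OF that assms(3)]
      by (simp add: mult.assoc[symmetric])
  qed
  then show ?thesis
    by (simp add: adjoint_numerator_def poly_sum sum_distrib_left)
qed

text \<open>The counterpart at infinity for \<open>Q = x ^ m\<close> and \<open>M = 0\<close>: the sum is the indicial polynomial at
  infinity evaluated at \<open>m - n + 1\<close>. All terms of the adjoint have the same degree bound
  \<open>m - n + n * degree R\<close>.\<close>
lemma adjoint_numerator_leading:
  assumes R: "lead_coeff R = 1" and A: "\<And>i. i \<le> n \<Longrightarrow> A i = 0 \<or> degree (A i) + i \<le> i * degree R"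
    and m: "n \<le> m"
  shows "degree (adjoint_numerator R A n 0 (Polynomial.monom 1 m)) \<le> m - n + n * degree R"
    and "coeff (adjoint_numerator R A n 0 (Polynomial.monom 1 m)) (m - n + n * degree R) =
      (-1) ^ n * (\<Sum>i\<le>n. (-1) ^ i * coeff (A i) (i * degree R - i)
                           * poly (rising_poly (n - i)) (of_nat (m - n + 1)))"
proof -
  let ?e = "m - n + n * degree R"
  let ?q = "\<lambda>i. quotient_higher_deriv R (n - i) i (A i * Polynomial.monom 1 m)"
  have main: "degree (?q i) \<le> ?e \<and>
      coeff (?q i) ?e = poly (rising_poly (n - i)) (of_nat (m - n + 1)) * coeff (A i) (i * degree R - i)"
    if i: "i \<le> n" for i
  proof (cases "A i = 0")
    case True
    have "quotient_higher_deriv R l N 0 = 0" for l N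
      by (induction l arbitrary: N) (simp_all add: quotient_deriv_def)
    then show ?thesis using True by simp
  next
    case False
    define d where "d = (i * degree R - i) + m"
    have di: "degree (A i) + i \<le> i * degree R" using A[OF i] False by simp
    have "degree (A i * Polynomial.monom 1 m) \<le> d"
      using di degree_mult_le[of "A i" "Polynomial.monom 1 m"] degree_monom_le[of "1::complex" m]
      unfolding d_def by linarith
    moreover have "?e + (n - i) = d + (n - i) * degree R"
    proof -
      have "n * degree R = i * degree R + (n - i) * degree R" using i by (simp flip: distrib_right)
      then show ?thesis using m i di unfolding d_def by linarith
    qed
    moreover have "coeff (A i * Polynomial.monom 1 m) d = coeff (A i) (i * degree R - i)"
      unfolding d_def using di coeff_mult_degree_bound[of "A i" "i * degree R - i" "Polynomial.monom 1 m" m]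
      by (simp add: degree_monom_le)
    moreover have "(\<Prod>j<n - i. of_nat d - of_nat (i * degree R) - of_nat j)
        = poly (rising_poly (n - i)) (of_nat (m - n + 1))"
    proof -
      have "(\<Prod>j<n - i. of_nat d - of_nat (i * degree R) - of_nat j)
          = (\<Prod>j<n - i. of_nat (n - i - Suc j) + of_nat (m - n + 1) :: complex)"
      proof (rule prod.cong)
        fix j assume "j \<in> {..<n - i}"
        then have "d = (n - i - Suc j) + (m - n + 1) + i * degree R + j"
          using di m by (auto simp: d_def)
        then have "of_nat d = (of_nat (n - i - Suc j) + of_nat (m - n + 1) + of_nat (i * degree R) + of_nat j :: complex)"
          by (metis of_nat_add)
        then show "of_nat d - of_nat (i * degree R) - of_nat j
            = (of_nat (n - i - Suc j) + of_nat (m - n + 1) :: complex)" by simp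
      qed simp
      also have "\<dots> = (\<Prod>j<n - i. of_nat j + of_nat (m - n + 1))"
        by (rule prod.nat_diff_reindex)
      finally show ?thesis by (simp add: rising_poly_def poly_prod)
    qed
    ultimately show ?thesis
      using quotient_higher_deriv_leading[OF R, of "A i * Polynomial.monom 1 m" d ?e "n - i" i] by simp
  qed
  show "degree (adjoint_numerator R A n 0 (Polynomial.monom 1 m)) \<le> ?e"
    unfolding adjoint_numerator_def using main
    by (intro degree_sum_le) (auto intro: order_trans[OF degree_smult_le])
  have sign: "(-1) ^ (n - i) = ((-1) ^ n * (-1) ^ i :: complex)" if "i \<le> n" for i
    using that by (simp add: uminus_power_if)
  show "coeff (adjoint_numerator R A n 0 (Polynomial.monom 1 m)) ?e =
      (-1) ^ n * (\<Sum>i\<le>n. (-1) ^ i * coeff (A i) (i * degree R - i)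
                           * poly (rising_poly (n - i)) (of_nat (m - n + 1)))"
    unfolding adjoint_numerator_def coeff_sum sum_distrib_left
    using main sign by (intro sum.cong) (auto simp: mult_ac)
qed

text \<open>If \<open>Q / R\<close> vanishes at infinity, so does the adjoint applied to \<open>Q / R ^ M\<close> for \<open>M \<ge> 1\<close>; this makes
  the removal of poles compatible with the absence of a polynomial part.\<close>
lemma degree_adjoint_numerator_less:
  assumes R: "lead_coeff R = 1" and r: "degree R \<ge> 1"
    and A: "\<And>i. i \<le> n \<Longrightarrow> A i = 0 \<or> degree (A i) + i \<le> i * degree R"
    and Q: "degree Q < degree R"
  shows "degree (adjoint_numerator R A n M Q) < Suc n * degree R"
proof -
  let ?r = "degree R - 1"
  have "degree (quotient_higher_deriv R (n - i) (M + i) (A i * Q)) \<le> Suc n * ?r" if i: "i \<le> n" for i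
  proof -
    have "degree (A i) \<le> i * ?r" using A[OF i] by (auto simp: diff_mult_distrib2)
    moreover have "degree Q \<le> ?r" using Q by simp
    ultimately have "degree (A i * Q) \<le> i * ?r + ?r" using degree_mult_le[of "A i" Q] by linarith
    then have "degree (quotient_higher_deriv R (n - i) (M + i) (A i * Q)) \<le> i * ?r + ?r + (n - i) * ?r"
      using degree_quotient_higher_deriv_le[OF R r, of "n - i" "M + i" "A i * Q"] by linarith
    also have "\<dots> = Suc n * ?r" using i by (simp flip: distrib_right)
    finally show ?thesis .
  qed
  then have "degree (adjoint_numerator R A n M Q) \<le> Suc n * ?r"
    unfolding adjoint_numerator_def
    by (intro degree_sum_le) (auto intro: order_trans[OF degree_smult_le])
  also have "\<dots> < Suc n * degree R" using r by (intro mult_strict_left_mono) auto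
  finally show ?thesis .
qed

section \<open>Reduction of differential forms\<close>

lemma pderiv_vanishing_poly_at_root:
  assumes "finite T" "t \<in> T"
  shows "poly (pderiv (vanishing_poly T)) t = poly (vanishing_poly (T - {t})) t"
    and "poly (vanishing_poly (T - {t})) t \<noteq> 0"
  using assms poly_vanishing_poly_eq_0_iff[of "T - {t}" t]
  unfolding vanishing_poly_remove[OF assms] pderiv_mult by (auto simp: pderiv_pCons)

text \<open>With \<open>Q = R / (x - t)\<close> one has \<open>Q ^ N / R ^ N = (x - t)\<^sup>-\<^sup>N\<close>; this is the derivative of that power.\<close>
lemma quotient_deriv_simple_pole_power:
  assumes "finite T" "t \<in> T"
  shows "quotient_deriv (vanishing_poly T) (Suc N) (vanishing_poly (T - {t}) ^ Suc N)
    = Polynomial.smult (- of_nat (Suc N)) (vanishing_poly (T - {t}) ^ Suc (Suc N))"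
proof -
  let ?Q = "vanishing_poly (T - {t})" and ?l = "[:- t, 1:]"
  have l: "pderiv ?l = 1" by (simp add: pderiv_pCons one_pCons)
  have "quotient_deriv (?l * ?Q) (Suc N) (?Q ^ Suc N)
      = Polynomial.smult (- of_nat (Suc N)) (?Q ^ Suc (Suc N))"
    unfolding quotient_deriv_def pderiv_mult l pderiv_power_Suc
    by (simp add: algebra_simps smult_add_right smult_diff_right del: mult_pCons_left mult_pCons_right of_nat_Suc)
  then show ?thesis by (simp only: vanishing_poly_remove[OF assms, symmetric])
qed

context complex_subfield
begin

definition function_subspace :: "(complex \<Rightarrow> complex) set \<Rightarrow> bool" where
  "function_subspace S \<longleftrightarrow> (\<lambda>_. 0) \<in> S \<and> (\<forall>g\<in>S. \<forall>h\<in>S. (\<lambda>x. g x + h x) \<in> S)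
     \<and> (\<forall>c\<in>k. \<forall>g\<in>S. (\<lambda>x. c * g x) \<in> S)"

lemma function_subspaceD:
  assumes "function_subspace S"
  shows "(\<lambda>_. 0) \<in> S"
    and "g \<in> S \<Longrightarrow> h \<in> S \<Longrightarrow> (\<lambda>x. g x + h x) \<in> S"
    and "c \<in> k \<Longrightarrow> g \<in> S \<Longrightarrow> (\<lambda>x. c * g x) \<in> S"
  using assms by (auto simp: function_subspace_def)

lemma function_subspace_diff:
  assumes "function_subspace S" "g \<in> S" "h \<in> S"
  shows "(\<lambda>x. g x - h x) \<in> S"
  using function_subspaceD(2)[OF assms(1,2) function_subspaceD(3)[OF assms(1) _ assms(3)], of "-1"]
  by simp

lemma function_subspace_sum:
  assumes "function_subspace S" "\<And>j. j \<in> J \<Longrightarrow> g j \<in> S"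
  shows "(\<lambda>x. \<Sum>j\<in>J. g j x) \<in> S"
  using assms(2)
  by (induction J rule: infinite_finite_induct) (auto intro: function_subspaceD[OF assms(1)])

end

text \<open>The equation after division by \<open>p 0\<close>, in the normal form given by the Fuchs conditions.\<close>
locale reduced_equation = complex_subfield k for k :: "complex set" +
  fixes T U :: "complex set" and n :: nat and A :: "nat \<Rightarrow> complex poly" and f :: "complex \<Rightarrow> complex"
  assumes T: "finite T" "T \<subseteq> k" and U: "open U" "U \<inter> T = {}"
    and f: "f holomorphic_on U"
    and A: "\<And>i. i \<le> n \<Longrightarrow> A i \<in> kx" and A_0: "A 0 = 1"
    and A_degree: "\<And>i. i \<le> n \<Longrightarrow> A i = 0 \<or> degree (A i) + i \<le> i * card T"
    and equation: "\<And>x. x \<in> U \<Longrightarrow>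
      (\<Sum>i\<le>n. poly (A i) x / poly (vanishing_poly T) x ^ i * (deriv ^^ (n - i)) f x) = 0"
begin

abbreviation R :: "complex poly" where "R \<equiv> vanishing_poly T"

definition form :: "complex poly \<Rightarrow> nat \<Rightarrow> nat \<Rightarrow> complex \<Rightarrow> complex" where
  "form P N i = one_form U (\<lambda>x. poly P x / poly R x ^ N * (deriv ^^ i) f x)"

lemma R_nonzero: "x \<in> U \<Longrightarrow> poly R x \<noteq> 0"
  using U(2) T(1) by (auto simp: poly_vanishing_poly_eq_0_iff)

lemma R_over [simp]: "R \<in> kx"
  using T(2) by (rule vanishing_poly_over)

lemma form_cancel: "form (P * R ^ m) (N + m) i = form P N i"
  using R_nonzero by (auto simp: form_def one_form_def fun_eq_iff power_add)

lemma form_0: "form 0 N i = (\<lambda>_. 0)"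
  and form_diff: "form (P - Q) N i = (\<lambda>x. form P N i x - form Q N i x)"
  and form_smult: "form (Polynomial.smult c P) N i = (\<lambda>x. c * form P N i x)"
  and form_sum: "form (\<Sum>j\<in>J. Pj j) N i = (\<lambda>x. \<Sum>j\<in>J. form (Pj j) N i x)"
  by (auto simp: form_def one_form_def fun_eq_iff left_diff_distrib diff_divide_distrib
      poly_sum sum_distrib_right sum_divide_distrib)

text \<open>The function \<open>q\<close> may have arbitrary values off \<open>U\<close>: the representatives of rational functions
  agree with fractions only away from the poles.\<close>
lemma form_deriv:
  assumes q: "\<And>x. x \<in> U \<Longrightarrow> q x = poly P x / poly R x ^ N"
  shows "one_form U (deriv (\<lambda>x. q x * (deriv ^^ i) f x))
    = (\<lambda>x. form (quotient_deriv R N P) (Suc N) i x + form P N (Suc i) x)"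
proof
  fix x
  show "one_form U (deriv (\<lambda>x. q x * (deriv ^^ i) f x)) x
      = form (quotient_deriv R N P) (Suc N) i x + form P N (Suc i) x"
  proof (cases "x \<in> U")
    case True
    have "(deriv ^^ i) f holomorphic_on U"
      by (rule holomorphic_higher_deriv[OF f U(1)])
    then have df: "((deriv ^^ i) f has_field_derivative (deriv ^^ Suc i) f x) (at x)"
      using holomorphic_derivI[OF _ U(1) True] by simp
    have dR: "((\<lambda>x. poly R x ^ N) has_field_derivative of_nat N * poly R x ^ (N - 1) * poly (pderiv R) x) (at x)"
      by (auto intro!: derivative_eq_intros)
    have "((\<lambda>x. poly P x / poly R x ^ N) has_field_derivative
        (poly (pderiv P) x * poly R x ^ N - poly P x * (of_nat N * poly R x ^ (N - 1) * poly (pderiv R) x))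
          / (poly R x ^ N * poly R x ^ N)) (at x)"
      using R_nonzero[OF True] by (intro DERIV_divide poly_DERIV dR) auto
    also have "(poly (pderiv P) x * poly R x ^ N - poly P x * (of_nat N * poly R x ^ (N - 1) * poly (pderiv R) x))
          / (poly R x ^ N * poly R x ^ N) = poly (quotient_deriv R N P) x / poly R x ^ Suc N"
      using R_nonzero[OF True] by (cases N) (simp_all add: quotient_deriv_def field_simps)
    finally have "((\<lambda>x. poly P x / poly R x ^ N) has_field_derivative
        poly (quotient_deriv R N P) x / poly R x ^ Suc N) (at x)" .
    from DERIV_mult[OF this df]
    have "((\<lambda>x. poly P x / poly R x ^ N * (deriv ^^ i) f x) has_field_derivative
        poly (quotient_deriv R N P) x / poly R x ^ Suc N * (deriv ^^ i) f x
          + (deriv ^^ Suc i) f x * (poly P x / poly R x ^ N)) (at x)" .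
    then have "((\<lambda>x. q x * (deriv ^^ i) f x) has_field_derivative
        poly (quotient_deriv R N P) x / poly R x ^ Suc N * (deriv ^^ i) f x
          + (deriv ^^ Suc i) f x * (poly P x / poly R x ^ N)) (at x)"
      by (rule has_field_derivative_transform_within_open[OF _ U(1) True]) (simp add: q)
    then show ?thesis using True by (simp add: DERIV_imp_deriv form_def one_form_def mult.commute)
  qed (simp add: form_def one_form_def)
qed

lemma equation_form: "(\<Sum>i\<le>n. form (A i * Q) (M + i) (n - i) x) = 0"
proof (cases "x \<in> U")
  case True
  have "(\<Sum>i\<le>n. form (A i * Q) (M + i) (n - i) x)
      = poly Q x / poly R x ^ M * (\<Sum>i\<le>n. poly (A i) x / poly R x ^ i * (deriv ^^ (n - i)) f x)"
    using True unfolding sum_distrib_left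
    by (intro sum.cong) (simp_all add: form_def one_form_def power_add)
  then show ?thesis using equation[OF True] by simp
qed (simp add: form_def one_form_def)

end

text \<open>The two sums are the indicial polynomials at \<open>t\<close> and at infinity, expressed by the \<open>A i\<close>; the
  arguments \<open>n - 1 + M\<close> and \<open>d\<close> run through the integers \<open>\<ge> n\<close> and the positive integers.\<close>
locale nonresonant_equation = reduced_equation +
  assumes nonresonant: "\<And>t M. t \<in> T \<Longrightarrow> M \<ge> 1 \<Longrightarrow>
      (\<Sum>i\<le>n. poly (A i) t / poly (pderiv R) t ^ i * poly (falling_poly (n - i)) (of_nat (n - 1 + M))) \<noteq> 0"
    and nonresonant_infinity: "\<And>d. d \<ge> 1 \<Longrightarrow>
      (\<Sum>i\<le>n. (-1) ^ i * coeff (A i) (i * card T - i) * poly (rising_poly (n - i)) (of_nat d)) \<noteq> 0"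

text \<open>Membership in \<open>S\<close> replaces equality of classes: two forms that differ by an exact form are both in \<open>S\<close>
  or both outside it. That the proposed generators suffice means that every such \<open>S\<close> contains all
  forms \<open>P / R ^ N f\<^sup>(\<^sup>i\<^sup>) dx\<close>.\<close>
locale cohomology_reduction = nonresonant_equation +
  fixes S :: "(complex \<Rightarrow> complex) set"
  assumes S: "function_subspace S"
    and S_exact: "\<And>P N i. P \<in> kx \<Longrightarrow> i < n \<Longrightarrow>
      (\<lambda>x. form (quotient_deriv R N P) (Suc N) i x + form P N (Suc i) x) \<in> S"
    and S_generator: "\<And>t i. t \<in> T \<Longrightarrow> i < n \<Longrightarrow> form (vanishing_poly (T - {t})) 1 i \<in> S"
begin

lemmas S_zero = function_subspaceD(1)[OF S]
  and S_add = function_subspaceD(2)[OF S]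
  and S_scale = function_subspaceD(3)[OF S]
  and S_diff = function_subspace_diff[OF S]
  and S_sum = function_subspace_sum[OF S]

lemma quotient_deriv_over: "P \<in> kx \<Longrightarrow> quotient_deriv R N P \<in> kx"
  unfolding quotient_deriv_def by (intro poly_over_diff poly_over_mult poly_over_smult) auto

lemma quotient_higher_deriv_over: "P \<in> kx \<Longrightarrow> quotient_higher_deriv R m N P \<in> kx"
  by (induction m arbitrary: N P) (auto intro: quotient_deriv_over)

text \<open>Integration by parts, moving all \<open>i\<close> derivatives from \<open>f\<close> to the coefficient.\<close>
lemma reduce_derivatives:
  "P \<in> kx \<Longrightarrow> i \<le> n \<Longrightarrow>
    (\<lambda>x. form P N i x - (-1) ^ i * form (quotient_higher_deriv R i N P) (N + i) 0 x) \<in> S"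
proof (induction i arbitrary: N P)
  case 0
  then show ?case using S_zero by simp
next
  case (Suc i)
  then have "(\<lambda>x. form (quotient_deriv R N P) (Suc N) i x - (-1) ^ i *
      form (quotient_higher_deriv R i (Suc N) (quotient_deriv R N P)) (Suc N + i) 0 x) \<in> S"
    by (intro Suc.IH) (auto intro: quotient_deriv_over)
  from S_diff[OF S_exact[of P i N] this] show ?case using Suc.prems by (simp add: algebra_simps)
qed

lemma form_in_S_of_reduced:
  assumes "P \<in> kx" "i \<le> n" "form (quotient_higher_deriv R i N P) (N + i) 0 \<in> S"
  shows "form P N i \<in> S"
  using S_add[OF reduce_derivatives[OF assms(1,2), of N] S_scale[OF _ assms(3)], of "(-1) ^ i"]
  by simp

text \<open>Lagrange's identity: the equation multiplied by \<open>Q / R ^ M\<close> vanishes, and moving all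
  derivatives onto the coefficients turns it into the adjoint.\<close>
lemma adjoint_in_S:
  assumes Q: "Q \<in> kx"
  shows "form (adjoint_numerator R A n M Q) (M + n) 0 \<in> S"
proof -
  let ?B = "\<lambda>i. quotient_higher_deriv R (n - i) (M + i) (A i * Q)"
  have "(\<lambda>x. \<Sum>i\<le>n. form (A i * Q) (M + i) (n - i) x - (-1) ^ (n - i) * form (?B i) (M + i + (n - i)) 0 x) \<in> S"
    using A Q by (intro S_sum reduce_derivatives) auto
  also have "(\<lambda>x. \<Sum>i\<le>n. form (A i * Q) (M + i) (n - i) x - (-1) ^ (n - i) * form (?B i) (M + i + (n - i)) 0 x)
      = (\<lambda>x. - form (adjoint_numerator R A n M Q) (M + n) 0 x)"
    by (simp add: fun_eq_iff sum_subtractf equation_form adjoint_numerator_def form_sum form_smult)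
  finally show ?thesis using S_scale[of "-1"] by fastforce
qed

lemma adjoint_numerator_over: "Q \<in> kx \<Longrightarrow> adjoint_numerator R A n M Q \<in> kx"
  unfolding adjoint_numerator_def using A
  by (intro poly_over_sum poly_over_smult quotient_higher_deriv_over poly_over_mult) auto

text \<open>A derivative of \<open>f\<close> is traded for one more pole order, starting from the generators
  \<open>(x - t)\<^sup>-\<^sup>1 f\<^sup>(\<^sup>i\<^sup>) dx\<close>. The restriction \<open>Suc N + i \<le> n\<close> keeps the derivative of \<open>f\<close> in the starting
  generator below \<open>n\<close>.\<close>
lemma simple_pole_power_in_S:
  assumes t: "t \<in> T"
  shows "Suc N + i \<le> n \<Longrightarrow> form (vanishing_poly (T - {t}) ^ Suc N) (Suc N) i \<in> S"
proof (induction N arbitrary: i)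
  case 0
  then show ?case using S_generator[OF t, of i] by simp
next
  case (Suc N)
  let ?Q = "vanishing_poly (T - {t})"
  have Q: "?Q \<in> kx" using T(2) by (intro vanishing_poly_over) auto
  have "(\<lambda>x. form (quotient_deriv R (Suc N) (?Q ^ Suc N)) (Suc (Suc N)) i x
      + form (?Q ^ Suc N) (Suc N) (Suc i) x) \<in> S"
    using Suc.prems Q by (intro S_exact) auto
  from S_diff[OF this Suc.IH[of "Suc i"]]
  have "form (quotient_deriv R (Suc N) (?Q ^ Suc N)) (Suc (Suc N)) i \<in> S"
    using Suc.prems by (simp del: power_Suc)
  then have "(\<lambda>x. - of_nat (Suc N) * form (?Q ^ Suc (Suc N)) (Suc (Suc N)) i x) \<in> S"
    unfolding quotient_deriv_simple_pole_power[OF T(1) t] form_smult .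
  from S_scale[OF _ this, of "inverse (- of_nat (Suc N))"]
  show ?case by (simp add: mult.assoc[symmetric] del: of_nat_Suc power_Suc)
qed

text \<open>A form with pole of exact order \<open>N\<close> at \<open>t\<close>, smaller pole order at the other points, and no
  polynomial part. For \<open>N \<le> n\<close> the form \<open>(x - t)\<^sup>-\<^sup>N f dx\<close> serves; for \<open>N > n\<close> the adjoint of
  \<open>R / (x - t)\<close> over \<open>R ^ (N - n)\<close>, whose leading coefficient at \<open>t\<close> is nonzero by nonresonance.\<close>
lemma pole_killer:
  assumes t: "t \<in> T" and N: "N \<ge> 1"
  shows "\<exists>B\<in>kx. degree B < N * card T \<and> poly B t \<noteq> 0 \<and> (\<forall>s\<in>T - {t}. poly B s = 0) \<and> form B N 0 \<in> S"
proof -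
  let ?Q = "vanishing_poly (T - {t})"
  have Q: "?Q \<in> kx" using T(2) by (intro vanishing_poly_over) auto
  have card: "card T = Suc (card (T - {t}))" using T(1) t by (rule card.remove)
  have Qs: "poly ?Q s = 0" if "s \<in> T - {t}" for s
    using that T(1) by (simp add: poly_vanishing_poly_eq_0_iff)
  note Qt = pderiv_vanishing_poly_at_root[OF T(1) t]
  show ?thesis
  proof (cases "N \<le> n")
    case True
    obtain m where m: "N = Suc m" using N by (cases N) auto
    have "degree (?Q ^ N) = N * card (T - {t})"
      using T(1) by (simp add: degree_power_eq degree_vanishing_poly)
    then have "degree (?Q ^ N) < N * card T" using N card by simp
    moreover have "form (?Q ^ N) N 0 \<in> S"
      unfolding m by (rule simple_pole_power_in_S[OF t]) (use True m in simp)
    ultimately show ?thesis using Q Qt(2) Qs N by (intro bexI[of _ "?Q ^ N"]) auto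
  next
    case False
    define M where "M = N - n"
    have M: "M \<ge> 1" "M + n = N" using False by (auto simp: M_def)
    let ?B = "adjoint_numerator R A n M ?Q"
    have root: "poly R s = 0" "poly (pderiv R) s \<noteq> 0" if "s \<in> T" for s
      using that T(1) pderiv_vanishing_poly_at_root[OF T(1) that] by (auto simp: poly_vanishing_poly_eq_0_iff)
    note at_root = adjoint_numerator_at_root[OF root M(1), of _ A n ?Q]
    have "degree ?B < Suc n * card T"
      unfolding degree_vanishing_poly[symmetric]
      by (rule degree_adjoint_numerator_less[OF lead_coeff_vanishing_poly])
        (use A_degree card in \<open>simp_all add: degree_vanishing_poly\<close>)
    also have "\<dots> \<le> N * card T" using False by (intro mult_right_mono) auto
    finally have "degree ?B < N * card T" .
    moreover have "poly ?B t \<noteq> 0" using at_root[OF t t] Qt(2) root(2)[OF t] nonresonant[OF t M(1)] by simp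
    moreover have "\<forall>s\<in>T - {t}. poly ?B s = 0" using at_root Qs by simp
    moreover have "form ?B N 0 \<in> S" using adjoint_in_S[OF Q, of M] M(2) by simp
    ultimately show ?thesis using adjoint_numerator_over[OF Q] by blast
  qed
qed

text \<open>Subtracting multiples of the forms from \<open>pole_killer\<close> makes the numerator vanish on \<open>T\<close>, so that
  a factor \<open>R\<close> cancels. The degree bound survives and leaves only \<open>P = 0\<close> for \<open>N = 0\<close>.\<close>
lemma proper_fraction_in_S:
  "P \<in> kx \<Longrightarrow> P = 0 \<or> degree P < N * card T \<Longrightarrow> form P N 0 \<in> S"
proof (induction N arbitrary: P)
  case 0
  then show ?case using S_zero by (simp add: form_0)
next
  case (Suc N)
  show ?case
  proof (cases "P = 0")
    case True
    then show ?thesis using S_zero by (simp add: form_0)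
  next
    case False
    then have deg: "degree P < Suc N * card T" using Suc.prems(2) by simp
    have "\<forall>t\<in>T. \<exists>B. B \<in> kx \<and> degree B < Suc N * card T \<and> poly B t \<noteq> 0
        \<and> (\<forall>s\<in>T - {t}. poly B s = 0) \<and> form B (Suc N) 0 \<in> S"
      using pole_killer[of _ "Suc N"] by auto
    then obtain B where B: "\<And>t. t \<in> T \<Longrightarrow> B t \<in> kx \<and> degree (B t) < Suc N * card T \<and> poly (B t) t \<noteq> 0
        \<and> (\<forall>s\<in>T - {t}. poly (B t) s = 0) \<and> form (B t) (Suc N) 0 \<in> S"
      by metis
    define c where "c t = poly P t / poly (B t) t" for t
    have c: "c t \<in> k" if "t \<in> T" for t
      using that T(2) Suc.prems(1) B unfolding c_def by (intro divide_closed poly_in_field) auto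
    define C where "C = (\<Sum>t\<in>T. Polynomial.smult (c t) (B t))"
    have "form C (Suc N) 0 \<in> S"
      unfolding C_def form_sum form_smult using B c by (intro S_sum S_scale) auto
    \<comment> \<open>the \<open>B t\<close> are, up to scaling, an interpolation basis on \<open>T\<close>\<close>
    have "poly (P - C) s = 0" if s: "s \<in> T" for s
    proof -
      have "poly C s = (\<Sum>t\<in>T. if t = s then poly P s else 0)"
        unfolding C_def poly_sum using B s by (intro sum.cong) (auto simp: c_def)
      then show ?thesis using s T(1) by simp
    qed
    then obtain D where D: "P - C = R * D" using vanishing_poly_dvd[OF T(1)] by blast
    have "C \<in> kx" unfolding C_def using B c by (intro poly_over_sum poly_over_smult) auto
    then have "D \<in> kx"
      using Suc.prems(1) D T(1) by (intro poly_over_cancel[of D R]) (auto simp: mult.commute[of D] D[symmetric])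
    have "degree (P - C) < Suc N * card T"
      unfolding C_def using deg B
      by (intro degree_diff_less degree_sum_less) (auto intro: le_less_trans[OF degree_smult_le])
    moreover have "D = 0 \<or> degree (R * D) = card T + degree D"
      using T(1) by (cases "D = 0") (simp_all add: degree_mult_eq degree_vanishing_poly)
    ultimately have "D = 0 \<or> degree D < N * card T"
      unfolding D by auto
    then have "form D N 0 \<in> S" using \<open>D \<in> kx\<close> by (intro Suc.IH)
    also have "form D N 0 = form (P - C) (Suc N) 0"
      unfolding D using form_cancel[of D 1 N 0] by (simp add: mult.commute)
    finally have "form (P - C) (Suc N) 0 \<in> S" .
    from S_add[OF this \<open>form C (Suc N) 0 \<in> S\<close>] show ?thesis by (simp add: form_diff)
  qed
qed

text \<open>The polynomial part is removed from the top: nonresonance at infinity provides an exact form whose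
  numerator has any prescribed degree \<open>\<ge> N * card T\<close>.\<close>
lemma fraction_in_S:
  "P \<in> kx \<Longrightarrow> n \<le> N \<Longrightarrow> form P N 0 \<in> S"
proof (induction "degree P" arbitrary: P rule: less_induct)
  case less
  show ?case
  proof (cases "P = 0 \<or> degree P < N * card T")
    case True
    then show ?thesis by (rule proper_fraction_in_S[OF less.prems(1)])
  next
    case False
    then have P: "P \<noteq> 0" "N * card T \<le> degree P" by auto
    \<comment> \<open>chosen so that the adjoint of \<open>x ^ m\<close> grows at infinity like \<open>P / R ^ N\<close>\<close>
    define m where "m = degree P - N * card T + n"
    have m: "n \<le> m" by (simp add: m_def)
    let ?X = "Polynomial.monom 1 m :: complex poly"
    define B where "B = adjoint_numerator R A n 0 ?X"
    define B' where "B' = B * R ^ (N - n)"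
    have lead: "degree B \<le> m - n + n * card T" "coeff B (m - n + n * card T) \<noteq> 0"
      using adjoint_numerator_leading[OF lead_coeff_vanishing_poly _ m, of A T, unfolded degree_vanishing_poly]
        A_degree nonresonant_infinity[of "m - n + 1"] by (auto simp: B_def simp del: of_nat_add of_nat_diff)
    then have degB: "degree B = m - n + n * card T" "B \<noteq> 0" by (auto intro: antisym le_degree)
    have "degree B' = degree B + (N - n) * card T"
      using degB(2) T(1) by (simp add: B'_def degree_mult_eq degree_power_eq degree_vanishing_poly)
    also have "\<dots> = degree P"
    proof -
      have "N * card T = n * card T + (N - n) * card T" using less.prems(2) by (simp flip: distrib_right)
      then show ?thesis using P(2) unfolding degB(1) m_def by simp
    qed
    finally have degB': "degree B' = degree P" .
    have "B' \<noteq> 0" using degB(2) T(1) by (simp add: B'_def)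
    have "B' \<in> kx" unfolding B'_def B_def using adjoint_numerator_over[of ?X 0] by (intro poly_over_mult poly_over_power) auto
    have "form B' N 0 = form B n 0" using form_cancel[of B "N - n" n 0] less.prems(2) by (simp add: B'_def)
    then have B'S: "form B' N 0 \<in> S" using adjoint_in_S[of ?X 0] by (simp add: B_def)
    define c where "c = lead_coeff P / lead_coeff B'"
    have "c \<in> k" using less.prems(1) \<open>B' \<in> kx\<close> unfolding c_def poly_over_def by auto
    let ?P = "P - Polynomial.smult c B'"
    have PB: "?P \<in> kx" using less.prems(1) \<open>c \<in> k\<close> \<open>B' \<in> kx\<close> by (intro poly_over_diff poly_over_smult)
    have "degree ?P \<le> degree P"
      using degB' by (intro degree_diff_le) (auto intro: order_trans[OF degree_smult_le])
    moreover have "coeff B' (degree P) \<noteq> 0"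
      using \<open>B' \<noteq> 0\<close> leading_coeff_0_iff[of B'] degB' by simp
    then have "coeff ?P (degree P) = 0"
      using \<open>B' \<noteq> 0\<close> degB' by (simp add: c_def)
    ultimately have "?P = 0 \<or> degree ?P < degree P" by (rule eq_zero_or_degree_less)
    then have "form ?P N 0 \<in> S"
      using less.hyps[of ?P] PB less.prems(2) S_zero by (auto simp: form_0)
    from S_add[OF this S_scale[OF \<open>c \<in> k\<close> B'S]] show ?thesis by (simp add: form_diff form_smult)
  qed
qed

lemma all_forms_in_S:
  assumes P: "P \<in> kx" and i: "i \<le> n"
  shows "form P N i \<in> S"
proof (rule form_in_S_of_reduced[OF P i])
  let ?P = "quotient_higher_deriv R i N P"
  have "form (?P * R ^ n) (N + i + n) 0 \<in> S"
    using quotient_higher_deriv_over[OF P] by (intro fraction_in_S poly_over_mult poly_over_power) auto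
  then show "form ?P (N + i) 0 \<in> S" by (simp add: form_cancel)
qed

end

section \<open>The de Rham group of an equation with nonresonant exponents\<close>

context complex_subfield
begin

lemma holomorphic_forms_module:
  "Module.module (complex_subring k) (holomorphic_forms U)"
proof (rule moduleI)
  show "cring (complex_subring k)" using field by (simp add: field_def domain_def)
  show "abelian_group (holomorphic_forms U)"
  proof (rule abelian_groupI)
    fix g assume "g \<in> carrier (holomorphic_forms U)"
    then show "\<exists>h\<in>carrier (holomorphic_forms U). h \<oplus>\<^bsub>holomorphic_forms U\<^esub> g = \<zero>\<^bsub>holomorphic_forms U\<^esub>"
      by (intro bexI[of _ "\<lambda>x. - g x"]) (auto simp: holomorphic_forms_def intro!: holomorphic_intros)
  qed (auto simp: holomorphic_forms_def fun_eq_iff add_ac intro!: holomorphic_intros)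
qed (auto simp: holomorphic_forms_def complex_subring_def fun_eq_iff algebra_simps intro!: holomorphic_intros)

lemma submodule_iff_function_subspace:
  "submodule S (complex_subring k) (holomorphic_forms U) \<longleftrightarrow>
     S \<subseteq> carrier (holomorphic_forms U) \<and> function_subspace S"
proof -
  interpret Module.module "complex_subring k" "holomorphic_forms U"
    by (rule holomorphic_forms_module)
  have ops: "\<zero>\<^bsub>holomorphic_forms U\<^esub> = (\<lambda>_. 0)"
    "g \<oplus>\<^bsub>holomorphic_forms U\<^esub> h = (\<lambda>x. g x + h x)" "c \<odot>\<^bsub>holomorphic_forms U\<^esub> g = (\<lambda>x. c * g x)"
    "carrier (complex_subring k) = k" for g h c
    by (simp_all add: holomorphic_forms_def complex_subring_def)
  show ?thesis
  proof
    assume S: "submodule S (complex_subring k) (holomorphic_forms U)"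
    then show "S \<subseteq> carrier (holomorphic_forms U) \<and> function_subspace S"
      using submoduleE(1,4,5)[OF S] subgroup.one_closed[OF submodule.axioms(1)[OF S]]
      by (simp add: function_subspace_def ops)
  next
    assume "S \<subseteq> carrier (holomorphic_forms U) \<and> function_subspace S"
    then show "submodule S (complex_subring k) (holomorphic_forms U)"
      by (intro submoduleI_smult) (auto simp: ops function_subspace_def)
  qed
qed

end

context reduced_equation
begin

abbreviation "M \<equiv> holomorphic_forms U"
abbreviation "K \<equiv> complex_subring k"
abbreviation "F \<equiv> dR_forms k T U n f"
abbreviation "E \<equiv> dR_exact k T U n f"

lemma rational_form:
  assumes "q \<in> rational_functions_poles k T"
  obtains P N where "P \<in> kx" "\<And>x. x \<in> U \<Longrightarrow> q x = poly P x / poly R x ^ N"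
    "\<And>i. one_form U (\<lambda>x. q x * (deriv ^^ i) f x) = form P N i"
proof -
  obtain P N where P: "P \<in> kx" "\<And>x. x \<notin> T \<Longrightarrow> q x = poly P x / poly R x ^ N"
    using rational_function_as_fraction[OF T assms] by blast
  have eq: "q x = poly P x / poly R x ^ N" if "x \<in> U" for x using P(2)[of x] U(2) that by blast
  show ?thesis by (rule that[OF P(1) eq]) (auto simp: form_def one_form_def fun_eq_iff eq)
qed

lemma fraction_form:
  assumes "P \<in> kx"
  obtains q where "q \<in> rational_functions_poles k T" "\<And>x. x \<in> U \<Longrightarrow> q x = poly P x / poly R x ^ N"
    "\<And>i. one_form U (\<lambda>x. q x * (deriv ^^ i) f x) = form P N i"
proof -
  have "\<exists>q\<in>rational_functions_poles k T. \<forall>x. x \<notin> T \<longrightarrow> q x = poly P x / poly (R ^ N) x"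
    using T assms poly_vanishing_poly_eq_0_iff[OF T(1)]
    by (intro fraction_as_rational_function) (auto simp: poly_power)
  then obtain q where q: "q \<in> rational_functions_poles k T" "\<And>x. x \<notin> T \<Longrightarrow> q x = poly P x / poly R x ^ N"
    by (auto simp: poly_power)
  have eq: "q x = poly P x / poly R x ^ N" if "x \<in> U" for x using q(2)[of x] U(2) that by blast
  show ?thesis by (rule that[OF q(1) eq]) (auto simp: form_def one_form_def fun_eq_iff eq)
qed

lemma form_holomorphic: "form P N i \<in> carrier M"
proof -
  have "(\<lambda>x. poly P x / poly R x ^ N * (deriv ^^ i) f x) holomorphic_on U"
    using R_nonzero by (intro holomorphic_intros holomorphic_higher_deriv[OF f U(1)]) auto
  then have "form P N i holomorphic_on U"
    by (rule holomorphic_transform) (simp add: form_def one_form_def)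
  then show ?thesis by (simp add: holomorphic_forms_def) (simp add: form_def one_form_def)
qed

lemma function_subspace_holomorphic_forms: "function_subspace (carrier M)"
  using submodule_iff_function_subspace[of "carrier M" U]
    Module.module.carrier_is_submodule[OF holomorphic_forms_module] by blast

lemma dR_forms_submodule: "submodule F K M"
  unfolding dR_forms_def
  by (rule module.lin_span_submodule[OF holomorphic_forms_module])
    (auto elim!: rational_form simp: form_holomorphic)

lemma dR_exact_submodule: "submodule E K M"
  unfolding dR_exact_def
proof (rule module.lin_span_submodule[OF holomorphic_forms_module], clarify)
  fix q i assume "q \<in> rational_functions_poles k T"
  then obtain P N where "\<And>x. x \<in> U \<Longrightarrow> q x = poly P x / poly R x ^ N" using rational_form by metis
  from form_deriv[OF this]
  show "one_form U (deriv (\<lambda>x. q x * (deriv ^^ i) f x)) \<in> carrier M"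
    using function_subspaceD(2)[OF function_subspace_holomorphic_forms form_holomorphic form_holomorphic]
    by simp
qed

lemma function_subspace_dR_forms: "function_subspace F"
  using dR_forms_submodule by (simp add: submodule_iff_function_subspace)

text \<open>For \<open>i = n\<close> the equation expresses the highest derivative by the lower ones. This is what makes
  the exact forms, in which the \<open>n\<close>-th derivative occurs, elements of the numerator of the cohomology group.\<close>
lemma form_in_dR_forms:
  assumes P: "P \<in> kx" and i: "i \<le> n"
  shows "form P N i \<in> F"
proof -
  have less: "form P N i \<in> F" if P: "P \<in> kx" and "i < n" for P N i
  proof -
    obtain q where "q \<in> rational_functions_poles k T"
      "\<And>i. one_form U (\<lambda>x. q x * (deriv ^^ i) f x) = form P N i"
      using fraction_form[OF P, of N] by metis
    then show ?thesis
      using that(2) unfolding dR_forms_def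
      by (intro subsetD[OF lin_span_superset]) (metis (mono_tags, lifting) mem_Collect_eq)
  qed
  show ?thesis
  proof (cases "i = n")
    case True
    have "{..n} = insert 0 {1..n}" by auto
    then have "form P N n x + (\<Sum>j\<in>{1..n}. form (A j * P) (N + j) (n - j) x) = 0" for x
      using equation_form[of P N x] by (simp add: A_0)
    then have "form P N n = (\<lambda>x. 0 - (\<Sum>j\<in>{1..n}. form (A j * P) (N + j) (n - j) x))"
      by (simp add: fun_eq_iff add_eq_0_iff2)
    also have "\<dots> \<in> F"
      using A P by (intro function_subspace_diff function_subspace_sum function_subspaceD(1)
          function_subspace_dR_forms less poly_over_mult) auto
    finally show ?thesis using True by simp
  qed (use less[OF P] i in auto)
qed

lemma dR_exact_subset_dR_forms: "E \<subseteq> F"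
  unfolding dR_exact_def
proof (rule lin_span_minimal[OF dR_forms_submodule], clarify)
  fix q i assume q: "q \<in> rational_functions_poles k T" and i: "i < n"
  obtain P N where P: "P \<in> kx" and "\<And>x. x \<in> U \<Longrightarrow> q x = poly P x / poly R x ^ N"
    using rational_form[OF q] by metis
  from form_deriv[OF this(2)]
  show "one_form U (deriv (\<lambda>x. q x * (deriv ^^ i) f x)) \<in> F"
    using P i by (auto simp: quotient_deriv_def
        intro!: function_subspaceD(2)[OF function_subspace_dR_forms] form_in_dR_forms)
qed

lemma simple_pole_form:
  assumes t: "t \<in> T"
  shows "one_form U (\<lambda>x. inverse (x - t) * (deriv ^^ i) f x) = form (vanishing_poly (T - {t})) 1 i"
proof -
  have "inverse (x - t) = poly (vanishing_poly (T - {t})) x / poly R x" if "x \<in> U" for x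
    using R_nonzero[OF that] unfolding vanishing_poly_remove[OF T(1) t]
    by (auto simp: field_simps)
  then show ?thesis by (auto simp: form_def one_form_def fun_eq_iff)
qed

end

text \<open>A submodule of the quotient containing the proposed generators pulls back to a space \<open>S\<close> as in
  \<open>cohomology_reduction\<close>, hence is everything.\<close>
lemma (in nonresonant_equation) cohomology_generated_by_simple_poles:
  defines "H \<equiv> H1_dR k T U n f"
    and "G \<equiv> {dR_class k T U n f (\<lambda>x. inverse (x - t) * (deriv ^^ i) f x) | t i. t \<in> T \<and> i < n}"
  shows "lin_span K H G = carrier H \<and> (\<exists>d\<le>n * card T. has_dimension K H d)"
proof -
  define MF where "MF = M\<lparr>carrier := F\<rparr>"
  interpret MF: Module.module K MF
    unfolding MF_def by (rule submodule.submodule_is_module[OF dR_forms_submodule holomorphic_forms_module])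
  have ops: "carrier MF = F" "\<zero>\<^bsub>MF\<^esub> = (\<lambda>_. 0)" "g \<oplus>\<^bsub>MF\<^esub> h = (\<lambda>x. g x + h x)"
    "c \<odot>\<^bsub>MF\<^esub> g = (\<lambda>x. c * g x)" "carrier K = k" for g h c
    by (simp_all add: MF_def holomorphic_forms_def complex_subring_def)
  have E: "submodule E K MF"
    using dR_exact_submodule dR_exact_subset_dR_forms
    by (intro MF.submoduleI_smult) (auto simp: ops submodule_iff_function_subspace function_subspace_def)
  have H: "H = quot_module MF E" by (simp add: H_def H1_dR_def MF_def)
  interpret H: Module.module K H unfolding H by (rule MF.quot_module_is_module[OF E])
  have coset: "E +>\<^bsub>M\<^esub> g = E +>\<^bsub>MF\<^esub> g" for g by (simp add: a_r_coset_def' MF_def)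
  have class_eq: "dR_class k T U n f (\<lambda>x. inverse (x - t) * (deriv ^^ i) f x)
      = E +>\<^bsub>MF\<^esub> form (vanishing_poly (T - {t})) 1 i" if "t \<in> T" for t i
    by (simp add: dR_class_def coset simple_pole_form[OF that])
  have pole_over: "vanishing_poly (T - {t}) \<in> kx" for t using T(2) by (intro vanishing_poly_over) auto
  have carrier: "carrier H = (\<lambda>g. E +>\<^bsub>MF\<^esub> g) ` F" by (simp add: H quot_module_carrier ops)
  have G: "G \<subseteq> carrier H"
    unfolding G_def carrier using class_eq form_in_dR_forms[OF pole_over] by fastforce
  have G_eq: "G = (\<lambda>(t, i). dR_class k T U n f (\<lambda>x. inverse (x - t) * (deriv ^^ i) f x)) ` (T \<times> {..<n})"
    by (auto simp: G_def)
  have "carrier H \<subseteq> N" if N: "submodule N K H" and "G \<subseteq> N" for N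
  proof -
    define S where "S = {g \<in> carrier MF. E +>\<^bsub>MF\<^esub> g \<in> N}"
    have Ssub: "submodule S K MF" and ES: "E \<subseteq> S"
      using MF.quot_module_preimage_submodule[OF E N[unfolded H]] by (simp_all add: S_def)
    have SF: "S \<subseteq> F" by (auto simp: S_def ops)
    have S: "function_subspace S"
      unfolding function_subspace_def
    proof (intro conjI ballI)
      show "(\<lambda>_. 0) \<in> S"
        using subgroup.one_closed[OF submodule.axioms(1)[OF Ssub]] by (simp add: ops)
      show "(\<lambda>x. g x + h x) \<in> S" if "g \<in> S" "h \<in> S" for g h
        using MF.submoduleE(5)[OF Ssub that] unfolding ops .
      show "(\<lambda>x. c * g x) \<in> S" if "c \<in> k" "g \<in> S" for c g
        using MF.submoduleE(4)[OF Ssub _ that(2), of c] that(1) unfolding ops by blast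
    qed
    interpret cohomology_reduction k T U n A f S
    proof
      fix P N i assume P: "P \<in> kx" and i: "i < n"
      obtain q where q: "q \<in> rational_functions_poles k T" "\<And>x. x \<in> U \<Longrightarrow> q x = poly P x / poly R x ^ N"
        using fraction_form[OF P, of N] by metis
      have "one_form U (deriv (\<lambda>x. q x * (deriv ^^ i) f x)) \<in> E"
        unfolding dR_exact_def using q(1) i by (intro subsetD[OF lin_span_superset]) blast
      then have "one_form U (deriv (\<lambda>x. q x * (deriv ^^ i) f x)) \<in> S" by (rule subsetD[OF ES])
      then show "(\<lambda>x. form (quotient_deriv R N P) (Suc N) i x + form P N (Suc i) x) \<in> S"
        using form_deriv[OF q(2), of i] by simp
    next
      fix t i assume t: "t \<in> T" and i: "i < n"
      have "E +>\<^bsub>MF\<^esub> form (vanishing_poly (T - {t})) 1 i \<in> G"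
        unfolding class_eq[OF t, symmetric] G_def using t i by blast
      then show "form (vanishing_poly (T - {t})) 1 i \<in> S"
        using \<open>G \<subseteq> N\<close> form_in_dR_forms[OF pole_over, of i t 1] i by (auto simp: S_def ops)
    qed (rule S)
    have "F \<subseteq> S"
      unfolding dR_forms_def
    proof (rule lin_span_minimal)
      show "submodule S K M"
        using S SF dR_forms_submodule by (auto simp: submodule_iff_function_subspace)
      show "{one_form U (\<lambda>x. q x * (deriv ^^ i) f x) |q i. q \<in> rational_functions_poles k T \<and> i < n} \<subseteq> S"
      proof clarify
        fix q i assume q: "q \<in> rational_functions_poles k T" and i: "i < n"
        obtain P N where "P \<in> kx" "one_form U (\<lambda>x. q x * (deriv ^^ i) f x) = form P N i"
          using rational_form[OF q] by metis
        then show "one_form U (\<lambda>x. q x * (deriv ^^ i) f x) \<in> S"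
          using all_forms_in_S i by simp
      qed
    qed
    then show ?thesis unfolding carrier by (auto simp: S_def)
  qed
  then have span: "lin_span K H G = carrier H"
    using lin_span_minimal[OF H.carrier_is_submodule G] by (auto simp: lin_span_def)
  have fin: "finite (T \<times> {..<n})" using T(1) by simp
  have "card G \<le> card (T \<times> {..<n})" and "finite G"
    unfolding G_eq by (rule card_image_le[OF fin], rule finite_imageI[OF fin])
  then have "card G \<le> n * card T" by (simp add: card_cartesian_product mult.commute)
  moreover obtain d where "d \<le> card G" "has_dimension K H d"
    using H.has_dimension_of_finite_generators[OF field \<open>finite G\<close> G span] by blast
  ultimately show ?thesis using span le_trans by blast
qed

section \<open>From the Fuchsian operator to its reduced equation\<close>

lemma eventually_not_in_finite_at:
  fixes z :: complex
  assumes "finite Z"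
  shows "\<forall>\<^sub>F x in at z. x \<notin> Z"
proof -
  have "open (- (Z - {z}))" using assms by (intro open_Compl finite_imp_closed) auto
  then show ?thesis unfolding eventually_at_topological by (intro exI[of _ "- (Z - {z})"]) auto
qed

lemma eventually_not_in_finite_at_infinity:
  fixes Z :: "complex set"
  assumes "finite Z"
  shows "\<forall>\<^sub>F x in at_infinity. x \<notin> Z"
proof -
  obtain b where "\<forall>x\<in>Z. norm x \<le> b"
    using finite_imp_bounded[OF assms] by (auto simp: bounded_iff)
  then show ?thesis by (intro eventually_at_infinityI[of "b + 1"]) force
qed

text \<open>Dividing the equation by \<open>p 0\<close> is only possible off its roots, some of which may lie in \<open>U\<close>
  if they are common roots of the coefficients; continuity covers these points.\<close>
lemma continuous_on_zero_off_finite: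
  fixes g :: "complex \<Rightarrow> complex"
  assumes "open U" "continuous_on U g" "finite Z" and zero: "\<And>x. x \<in> U \<Longrightarrow> x \<notin> Z \<Longrightarrow> g x = 0"
    and x: "x \<in> U"
  shows "g x = 0"
proof -
  have "(g \<longlongrightarrow> g x) (at x)"
    using assms(1,2) x by (simp add: continuous_on_eq_continuous_at isCont_def)
  moreover have "\<forall>\<^sub>F w in at x. w \<in> U"
    using assms(1) x by (rule eventually_at_in_open')
  then have "\<forall>\<^sub>F w in at x. g w = 0"
    using eventually_not_in_finite_at[OF assms(3), of x] by eventually_elim (rule zero)
  then have "(g \<longlongrightarrow> 0) (at x)" by (rule tendsto_eventually)
  ultimately show ?thesis by (rule tendsto_unique[rotated]) simp
qed

lemma poly_div_power_tendsto_at_infinity: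
  fixes p :: "complex poly"
  assumes "degree p \<le> m"
  shows "((\<lambda>x. poly p x / x ^ m) \<longlongrightarrow> coeff p m) at_infinity"
proof (cases "degree p = m")
  case True
  then show ?thesis using poly_divide_tendsto_aux[of p] by simp
next
  case False
  then have "degree p < m" using assms by simp
  then show ?thesis
    using poly_divide_tendsto_0_at_infinity[of p "Polynomial.monom 1 m"]
    by (simp add: degree_monom_eq poly_monom coeff_eq_0)
qed

text \<open>Near \<open>t\<close> the factor \<open>(x - t) ^ i\<close> cancels in \<open>A / R ^ i\<close> and leaves the cofactor
  \<open>R / (x - t)\<close>, whose value at \<open>t\<close> is the derivative of \<open>R\<close>.\<close>
lemma indicial_coeff_reduced:
  assumes T: "finite T" "t \<in> T" and "p 0 \<noteq> 0" and A: "p i * vanishing_poly T ^ i = A * p 0"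
  shows "indicial_coeff p t i = poly A t / poly (pderiv (vanishing_poly T)) t ^ i"
proof -
  let ?Q = "vanishing_poly (T - {t})" and ?R = "vanishing_poly T"
  note Qt = pderiv_vanishing_poly_at_root[OF T]
  have "((\<lambda>x. poly A x / poly ?Q x ^ i) \<longlongrightarrow> poly A t / poly ?Q t ^ i) (at t)"
    using Qt(2) by (intro tendsto_intros) auto
  moreover have "\<forall>\<^sub>F x in at t. x \<notin> {x. poly (p 0) x = 0} \<union> T"
    using T assms(3) by (intro eventually_not_in_finite_at finite_UnI poly_roots_finite)
  then have "\<forall>\<^sub>F x in at t. poly A x / poly ?Q x ^ i = (x - t) ^ i * normalized_coeff p i x"
  proof eventually_elim
    case (elim x)
    define u where "u = x - t"
    have "poly (p i) x * poly ?R x ^ i = poly A x * poly (p 0) x"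
      using arg_cong[OF A, of "\<lambda>q. poly q x"] by (simp add: poly_power)
    moreover have R: "poly ?R x = u * poly ?Q x"
      unfolding vanishing_poly_remove[OF T] by (simp add: u_def algebra_simps)
    moreover have "poly ?R x \<noteq> 0" using elim T by (simp add: poly_vanishing_poly_eq_0_iff)
    ultimately show ?case
      unfolding u_def[symmetric] R normalized_coeff_def
      using elim by (simp add: divide_simps) (simp add: power_mult_distrib mult_ac)
  qed
  ultimately have "((\<lambda>x. (x - t) ^ i * normalized_coeff p i x) \<longlongrightarrow> poly A t / poly ?Q t ^ i) (at t)"
    by (rule Lim_transform_eventually)
  then show ?thesis
    unfolding indicial_coeff_def Qt(1) by (intro tendsto_Lim) simp_all
qed

lemma indicial_coeff_infinity_reduced:
  assumes T: "finite T" and "p 0 \<noteq> 0" and A: "p i * vanishing_poly T ^ i = A * p 0"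
    and deg: "A = 0 \<or> degree A + i \<le> i * card T"
  shows "indicial_coeff_infinity p i = (-1) ^ i * coeff A (i * card T - i)"
proof (cases "A = 0")
  case True
  then have "p i = 0" using A T by simp
  then have "(\<lambda>x. (- x) ^ i * normalized_coeff p i x) = (\<lambda>_. 0)"
    by (simp add: normalized_coeff_def fun_eq_iff)
  then show ?thesis
    using True unfolding indicial_coeff_infinity_def by (simp add: tendsto_Lim[OF trivial_limit_at_infinity tendsto_const])
next
  case False
  let ?R = "vanishing_poly T"
  let ?m = "i * card T - i"
  have m: "degree A \<le> ?m" "i * card T = ?m + i" using deg False by auto
  have degR: "degree (?R ^ i) = i * card T" "coeff (?R ^ i) (i * card T) = 1"
  proof -
    show "degree (?R ^ i) = i * card T" using T by (simp add: degree_power_eq degree_vanishing_poly)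
    then show "coeff (?R ^ i) (i * card T) = 1"
      using lead_coeff_power[of ?R i] lead_coeff_vanishing_poly[of T] by simp
  qed
  have "((\<lambda>x. (-1) ^ i * (poly A x / x ^ ?m) / (poly (?R ^ i) x / x ^ (i * card T)))
      \<longlongrightarrow> (-1) ^ i * coeff A ?m / 1) at_infinity"
    unfolding degR(2)[symmetric]
    by (intro tendsto_intros poly_div_power_tendsto_at_infinity) (use degR m in auto)
  moreover have "\<forall>\<^sub>F x in at_infinity. x \<notin> {x. poly (p 0) x = 0} \<union> T \<union> {0}"
    using T assms(2) by (intro eventually_not_in_finite_at_infinity finite_UnI poly_roots_finite) auto
  then have "\<forall>\<^sub>F x in at_infinity. (-1) ^ i * (poly A x / x ^ ?m) / (poly (?R ^ i) x / x ^ (i * card T))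
      = (- x) ^ i * normalized_coeff p i x"
  proof eventually_elim
    case (elim x)
    define W where "W = poly (?R ^ i) x"
    have "poly (p i) x * W = poly A x * poly (p 0) x"
      using arg_cong[OF A, of "\<lambda>q. poly q x"] by (simp add: W_def)
    moreover have W: "W \<noteq> 0" using elim T by (simp add: W_def poly_power poly_vanishing_poly_eq_0_iff)
    ultimately have quot: "normalized_coeff p i x = poly A x / W"
      using elim by (simp add: normalized_coeff_def frac_eq_eq)
    have "x ^ (i * card T) = x ^ ?m * x ^ i"
      using power_add[of x ?m i] unfolding m(2)[symmetric] .
    moreover have "x ^ ?m \<noteq> 0" using elim by simp
    ultimately have eq: "(poly A x / x ^ ?m) / (W / x ^ (i * card T)) = x ^ i * (poly A x / W)"
      using W by simp
    have "(-1) ^ i * (poly A x / x ^ ?m) / (W / x ^ (i * card T))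
        = (-1) ^ i * ((poly A x / x ^ ?m) / (W / x ^ (i * card T)))"
      by (rule times_divide_eq_right[symmetric])
    also have "\<dots> = (- x) ^ i * normalized_coeff p i x"
      by (simp only: eq quot power_minus[of x i] mult.assoc)
    finally show ?case unfolding W_def .
  qed
  ultimately have "((\<lambda>x. (- x) ^ i * normalized_coeff p i x) \<longlongrightarrow> (-1) ^ i * coeff A ?m / 1) at_infinity"
    by (rule Lim_transform_eventually)
  then show ?thesis
    unfolding indicial_coeff_infinity_def by (intro tendsto_Lim trivial_limit_at_infinity) simp
qed

theorem theorem1:
  fixes k U :: "complex set" and n r :: nat and p :: "nat \<Rightarrow> complex poly"
    and t :: "nat \<Rightarrow> complex" and f :: "complex \<Rightarrow> complex"
  assumes "alg_closed_subfield k"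
    and "n \<ge> 1"
    and "\<forall>i\<le>n. p i \<in> poly_over k"
    and "p 0 \<noteq> 0"
    and "fuchsian n p"
    and "inj_on t {1..r}"
    and "t ` {1..r} \<subseteq> k"
    and "finite_singularities n p = t ` {1..r}"
    and "open U" and "U \<noteq> {}" and "simply_connected U" and "U \<inter> t ` {1..r} = {}"
    and "is_solution n p U f"
    and "\<forall>z::complex. \<forall>m::int. m \<ge> int n \<longrightarrow> of_int m \<notin> exponents n p z"
    and "\<forall>m::int. m > 0 \<longrightarrow> of_int m \<notin> exponents_infinity n p"
  shows "lin_span (complex_subring k) (H1_dR k (t ` {1..r}) U n f)
           {dR_class k (t ` {1..r}) U n f (\<lambda>x. inverse (x - t j) * (deriv ^^ i) f x) | j i.
              j \<in> {1..r} \<and> i < n}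
         = carrier (H1_dR k (t ` {1..r}) U n f)
       \<and> (\<exists>d \<le> n * r. has_dimension (complex_subring k) (H1_dR k (t ` {1..r}) U n f) d)"
proof -
  define T where "T = t ` {1..r}"
  have T: "finite T" "T \<subseteq> k" and card_T: "card T = r"
    using assms(6,7) by (auto simp: T_def card_image)
  interpret complex_subfield k
    using assms(1) unfolding alg_closed_subfield_def by (intro complex_subfield.intro) simp
  have "\<exists>B\<in>kx. p i * vanishing_poly T ^ i = B * p 0 \<and> (B = 0 \<or> degree B + i \<le> i * card T)"
    if "i \<le> n" for i
  proof (cases "i = 0")
    case True
    then show ?thesis by (intro bexI[of _ 1]) auto
  next
    case False
    then show ?thesis
      using that assms(3,4,5,8) T by (intro fuchsian_coefficient[of T p i n]) (auto simp: T_def)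
  qed
  then obtain A where reduced: "\<And>i. i \<le> n \<Longrightarrow> A i \<in> kx \<and> p i * vanishing_poly T ^ i = A i * p 0
      \<and> (A i = 0 \<or> degree (A i) + i \<le> i * card T)"
    by metis
  have A_0: "A 0 = 1" using reduced[of 0] assms(4) by simp
  have split: "{..n} = insert 0 {1..n}" by auto
  have UT: "U \<inter> T = {}" using assms(12) by (simp add: T_def)
  have f: "f holomorphic_on U" using assms(13) by (simp add: is_solution_def)
  interpret reduced_equation k T U n A f
  proof
    fix x assume x: "x \<in> U"
    let ?g = "\<lambda>x. \<Sum>i\<le>n. poly (A i) x / poly (vanishing_poly T) x ^ i * (deriv ^^ (n - i)) f x"
    have R0: "poly (vanishing_poly T) w \<noteq> 0" if "w \<in> U" for w
      using that UT T(1) by (auto simp: poly_vanishing_poly_eq_0_iff)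
    show "?g x = 0"
    proof (rule continuous_on_zero_off_finite[OF assms(9) _ _ _ x])
      have "?g holomorphic_on U"
        using R0 by (intro holomorphic_intros holomorphic_higher_deriv[OF f assms(9)]) auto
      then show "continuous_on U ?g" by (rule holomorphic_on_imp_continuous_on)
      show "finite {w. poly (p 0) w = 0}" using assms(4) by (rule poly_roots_finite)
    next
      fix w assume w: "w \<in> U" "w \<notin> {w. poly (p 0) w = 0}"
      have "poly (p i) w * y = poly (p 0) w * (poly (A i) w / poly (vanishing_poly T) w ^ i * y)"
        if "i \<le> n" for i y
      proof -
        have "p i * vanishing_poly T ^ i = A i * p 0" using reduced[OF that] by simp
        from arg_cong[OF this, of "\<lambda>q. poly q w"] show ?thesis
          using R0[OF w(1)] by (simp add: poly_power field_simps)
      qed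
      then have "(\<Sum>i\<le>n. poly (p i) w * (deriv ^^ (n - i)) f w) = poly (p 0) w * ?g w"
        unfolding sum_distrib_left by (intro sum.cong) blast+
      then show "?g w = 0" using w assms(13) by (simp add: is_solution_def)
    qed
  qed (use T UT f reduced A_0 assms(9) in auto)
  interpret nonresonant_equation k T U n A f
  proof
    fix s and M :: nat assume s: "s \<in> T" and M: "M \<ge> 1"
    have "of_int (int (n - 1 + M)) \<notin> exponents n p s"
      using assms(2) M by (intro assms(14)[rule_format]) simp
    then have "poly (indicial_poly n p s) (of_nat (n - 1 + M)) \<noteq> 0"
      by (simp add: exponents_def del: of_nat_add of_nat_diff)
    moreover have "indicial_coeff p s i = poly (A i) s / poly (pderiv R) s ^ i" if "i \<in> {1..n}" for i
    proof (rule indicial_coeff_reduced[where p = p, OF T(1) s assms(4)])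
      show "p i * R ^ i = A i * p 0" using reduced[of i] that by simp
    qed
    ultimately show "(\<Sum>i\<le>n. poly (A i) s / poly (pderiv R) s ^ i
        * poly (falling_poly (n - i)) (of_nat (n - 1 + M))) \<noteq> 0"
      by (simp add: indicial_poly_def poly_sum split A_0 del: of_nat_add of_nat_diff)
  next
    fix d :: nat assume d: "d \<ge> 1"
    have "of_int (int d) \<notin> exponents_infinity n p"
      using assms(15) d by (intro assms(15)[rule_format]) simp
    then have "poly (indicial_poly_infinity n p) (of_nat d) \<noteq> 0"
      by (simp add: exponents_infinity_def)
    moreover have "indicial_coeff_infinity p i = (-1) ^ i * coeff (A i) (i * card T - i)" if "i \<in> {1..n}" for i
      using reduced[of i] that by (intro indicial_coeff_infinity_reduced T(1) assms(4)) auto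
    ultimately show "(\<Sum>i\<le>n. (-1) ^ i * coeff (A i) (i * card T - i)
        * poly (rising_poly (n - i)) (of_nat d)) \<noteq> 0"
      by (simp add: indicial_poly_infinity_def poly_sum split A_0)
  qed
  have "{dR_class k T U n f (\<lambda>x. inverse (x - t j) * (deriv ^^ i) f x) | j i. j \<in> {1..r} \<and> i < n}
      = {dR_class k T U n f (\<lambda>x. inverse (x - s) * (deriv ^^ i) f x) | s i. s \<in> T \<and> i < n}"
    unfolding T_def by blast
  then show ?thesis
    using cohomology_generated_by_simple_poles unfolding card_T by (simp add: T_def)
qed

end
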